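(* There exists a constant $C>0$ such that, for every integer $N\ge 1$, with $\Theta(z)=z^N$, any truncated Toeplitz operator $A_\phi^\Theta$ on $K_\Theta$ ($\phi\in L^2$) has a symbol $\phi_0\in L^\infty$ such that $\|\phi_0\|_\infty\le C\,\rho(A_\phi^\Theta)$. (The constant $C$ is independent of $N$.)
   Context: $\mathbb D$ is the open unit disc, $\mathbb T$ the unit circle with normalized Lebesgue measure $m$, $L^p=L^p(\mathbb T,m)$, and $H^p$ is the Hardy space, regarded as a subspace of $L^p$ via boundary values. For an inner function $\Theta$ (nonconstant $\Theta\in H^\infty$ with $|\Theta|=1$ a.e. on $\mathbb T$), $K_\Theta=H^2\ominus\Theta H^2$ and $P_\Theta$ is the orthogonal projection of $L^2$ onto $K_\Theta$. For $\phi\in L^2$, the truncated Toeplitz operator $A_\phi^\Theta$ is the densely defined operator in $K_\Theta$ with domain $K_\Theta\cap H^\infty$, $A_\phi^\Theta f=P_\Theta(\phi f)$. A symbol of a truncated Toeplitz operator $A$ is any $\phi\in L^2$ with $A=A_\phi^\Theta$; it is not unique. For $\lambda\in\mathbb D$ put $$h_\lambda^\Theta(z)=\sqrt{\frac{1-|\lambda|^2}{1-|\Theta(\lambda)|^2}}\,\frac{1-\overline{\Theta(\lambda)}\Theta(z)}{1-\bar\lambda z},\qquad \tilde h_\lambda^\Theta(z)=\sqrt{\frac{1-|\lambda|^2}{1-|\Theta(\lambda)|^2}}\,\frac{\Theta(z)-\Theta(\lambda)}{z-\lambda}$$ (normalized reproducing kernel and normalized difference quotient, both in $K_\Theta\cap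 H^\infty$). For a linear operator $T$ whose domain contains $K_\Theta\cap H^\infty$, $\rho_r(T)=\sup_{\lambda\in\mathbb D}\|Th_\lambda^\Theta\|_2$, $\rho_d(T)=\sup_{\lambda\in\mathbb D}\|T\tilde h_\lambda^\Theta\|_2$, and $\rho(T)=\max\{\rho_r(T),\rho_d(T)\}$. *)

theory Defs
  imports "HOL-Probability.Essential_Supremum"
begin

text \<open>
  Elements of \<open>L\<^sup>p\<close> are represented by Borel functions, and two representatives are identified when
  they agree almost everywhere. A function \<open>\<Theta> :: complex \<Rightarrow> complex\<close> stands for an
  inner function together with its boundary values: \<open>\<Theta> z\<close> is used both for
  \<open>z\<close> in the open disc and for \<open>z\<close> on the unit circle.
\<close>

definition circle_measure :: "complex measure" where
  "circle_measure =
     distr (uniform_measure lborel {0..<2 * pi}) (restrict_space borel (sphere 0 1)) cis"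

definition L2 :: "(complex \<Rightarrow> complex) set" where
  "L2 = {f \<in> borel_measurable circle_measure.
           integrable circle_measure (\<lambda>z. (norm (f z))\<^sup>2)}"

definition L2_inner :: "(complex \<Rightarrow> complex) \<Rightarrow> (complex \<Rightarrow> complex) \<Rightarrow> complex" where
  "L2_inner f g = (\<integral>z. f z * cnj (g z) \<partial>circle_measure)"

definition L2_norm :: "(complex \<Rightarrow> complex) \<Rightarrow> real" where
  "L2_norm f = sqrt (\<integral>z. (norm (f z))\<^sup>2 \<partial>circle_measure)"

definition Linf_norm :: "(complex \<Rightarrow> complex) \<Rightarrow> ennreal" where
  "Linf_norm f = esssup circle_measure (\<lambda>z. ennreal (norm (f z)))"

definition Linf :: "(complex \<Rightarrow> complex) set" where
  "Linf = {f \<in> borel_measurable circle_measure. Linf_norm f < \<infinity>}"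

definition has_boundary_values :: "(complex \<Rightarrow> complex) \<Rightarrow> (complex \<Rightarrow> complex) \<Rightarrow> bool" where
  "has_boundary_values F f \<longleftrightarrow>
     (AE z in circle_measure. ((\<lambda>r. F (of_real r * z)) \<longlongrightarrow> f z) (at_left 1))"

definition H2 :: "(complex \<Rightarrow> complex) set" where
  "H2 = {f \<in> L2. \<exists>F. F holomorphic_on ball 0 1 \<and>
           bdd_above ((\<lambda>r. L2_norm (\<lambda>z. F (of_real r * z))) ` {0..<1}) \<and>
           has_boundary_values F f}"

definition Hinf :: "(complex \<Rightarrow> complex) set" where
  "Hinf = {f \<in> Linf. \<exists>F. F holomorphic_on ball 0 1 \<and> bounded (F ` ball 0 1) \<and>
             has_boundary_values F f}"

definition model_space :: "(complex \<Rightarrow> complex) \<Rightarrow> (complex \<Rightarrow> complex) set" where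
  "model_space \<Theta> = {f \<in> H2. \<forall>g\<in>H2. L2_inner f (\<lambda>z. \<Theta> z * g z) = 0}"

text \<open>
  The orthogonal projection is determined up to equality almost everywhere; \<open>SOME\<close> picks a
  representative, the same one for almost everywhere equal arguments in \<open>L\<^sup>2\<close>.
\<close>
definition model_proj ::
  "(complex \<Rightarrow> complex) \<Rightarrow> (complex \<Rightarrow> complex) \<Rightarrow> complex \<Rightarrow> complex" where
  "model_proj \<Theta> g =
     (SOME f. f \<in> model_space \<Theta> \<and> (\<forall>k\<in>model_space \<Theta>. L2_inner (\<lambda>z. g z - f z) k = 0))"

definition tto_domain :: "(complex \<Rightarrow> complex) \<Rightarrow> (complex \<Rightarrow> complex) set" where
  "tto_domain \<Theta> = model_space \<Theta> \<inter> Hinf"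

text \<open>Only the values of \<open>tto \<Theta> \<phi>\<close> on \<open>tto_domain \<Theta>\<close> are meaningful.\<close>
definition tto ::
  "(complex \<Rightarrow> complex) \<Rightarrow> (complex \<Rightarrow> complex) \<Rightarrow> (complex \<Rightarrow> complex) \<Rightarrow> complex \<Rightarrow> complex" where
  "tto \<Theta> \<phi> f = model_proj \<Theta> (\<lambda>z. \<phi> z * f z)"

definition is_symbol ::
  "(complex \<Rightarrow> complex) \<Rightarrow> ((complex \<Rightarrow> complex) \<Rightarrow> complex \<Rightarrow> complex) \<Rightarrow> (complex \<Rightarrow> complex) \<Rightarrow> bool" where
  "is_symbol \<Theta> T \<phi> \<longleftrightarrow> \<phi> \<in> L2 \<and>
     (\<forall>f\<in>tto_domain \<Theta>. AE z in circle_measure. T f z = tto \<Theta> \<phi> f z)"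

definition nkernel :: "(complex \<Rightarrow> complex) \<Rightarrow> complex \<Rightarrow> complex \<Rightarrow> complex" where
  "nkernel \<Theta> l z =
     of_real (sqrt ((1 - (norm l)\<^sup>2) / (1 - (norm (\<Theta> l))\<^sup>2))) *
     ((1 - cnj (\<Theta> l) * \<Theta> z) / (1 - cnj l * z))"

definition ndiffquot :: "(complex \<Rightarrow> complex) \<Rightarrow> complex \<Rightarrow> complex \<Rightarrow> complex" where
  "ndiffquot \<Theta> l z =
     of_real (sqrt ((1 - (norm l)\<^sup>2) / (1 - (norm (\<Theta> l))\<^sup>2))) *
     ((\<Theta> z - \<Theta> l) / (z - l))"

definition rho_r ::
  "(complex \<Rightarrow> complex) \<Rightarrow> ((complex \<Rightarrow> complex) \<Rightarrow> complex \<Rightarrow> complex) \<Rightarrow> ennreal" where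
  "rho_r \<Theta> T = (SUP l\<in>ball 0 1. ennreal (L2_norm (T (nkernel \<Theta> l))))"

definition rho_d ::
  "(complex \<Rightarrow> complex) \<Rightarrow> ((complex \<Rightarrow> complex) \<Rightarrow> complex \<Rightarrow> complex) \<Rightarrow> ennreal" where
  "rho_d \<Theta> T = (SUP l\<in>ball 0 1. ennreal (L2_norm (T (ndiffquot \<Theta> l))))"

definition rho ::
  "(complex \<Rightarrow> complex) \<Rightarrow> ((complex \<Rightarrow> complex) \<Rightarrow> complex \<Rightarrow> complex) \<Rightarrow> ennreal" where
  "rho \<Theta> T = max (rho_r \<Theta> T) (rho_d \<Theta> T)"

end

theory Submission
  imports Defs "HOL-Probability.Probability_Measure" "HOL-Complex_Analysis.Cauchy_Integral_Formula"
begin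

text \<open>
For \<open>\<Theta>(z) = z\<^sup>N\<close> the model space consists of the polynomials of degree less than \<open>N\<close>, and
\<open>A\<^sub>\<phi>\<close> is the Toeplitz matrix of the Fourier coefficients of \<open>\<phi>\<close> of index between \<open>-(N-1)\<close> and
\<open>N-1\<close>. A function is a symbol as soon as it has these Fourier coefficients. Reversing the order of the
rows turns the Toeplitz matrix into the Hankel matrix \<open>c (i + j)\<close>, \<open>i, j < N\<close>, where
\<open>c m = \<integral> \<phi> z * cnj z ^ (N-1) * z ^ m\<close> for \<open>m \<le> 2N-2\<close>. The normalized kernel at \<open>l\<close> is a multiple of
\<open>\<Sum> cnj l ^ j * z ^ j\<close>, the difference quotient a multiple of the same sum with the coefficients in
reverse order, so \<open>\<rho>\<close> bounds the action of the matrices \<open>c (i + j)\<close> and \<open>c (2N-2-i-j)\<close> on geometric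
vectors (\<open>kernel_test_of_rho\<close>).

The heart of the matter is the estimate \<open>|\<Sum> c m * q m| \<le> 19 \<rho> \<integral> |\<Sum> q m * z ^ m|\<close> for all
coefficients \<open>q\<close> (\<open>toeplitz_pairing_le\<close>). By duality between \<open>L\<^sup>1\<close> and \<open>L\<^sup>\<infinity>\<close> it yields a
function bounded by \<open>38 \<rho>\<close> with the prescribed coefficients. Duality is made explicit: a near-minimizer
\<open>Q\<close> of a convex functional provides the function \<open>K * cnj Q / sqrt (|Q|\<^sup>2 + 1)\<close>, whose coefficients
are almost right (\<open>symbol_of_bounded_pairing\<close>).

For the estimate, the functional is split by three weights with sum \<open>1\<close>: the Fejer weight
\<open>1 - |N-1-m| / N\<close>, and the two ramps \<open>(N-1-m)\<^sup>+ / N\<close> and \<open>(m-(N-1))\<^sup>+ / N\<close>. The Fejer part is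
controlled by the kernels at points of the circle alone (\<open>middle_pairing_le\<close>). A ramp cuts the matrix down
to a triangle; it is the transform of a modulated Fejer kernel, which has \<open>L\<^sup>1\<close> norm \<open>1\<close>, and rotations
map kernels to kernels, so multiplication by the ramp does not increase the bound on kernels
(\<open>kernel_test_edge\<close>). A triangular matrix of this kind is a finitely supported Hankel matrix on the
whole of \<open>\<ell>\<^sup>2\<close>, tested on all normalized kernels of the Hardy space.

What remains is the reproducing kernel thesis for Hankel matrices in the strong form of Fefferman's
duality theorem (\<open>hankel_pairing_le\<close>): if \<open>\<beta>(z) = \<Sum> cnj (b m) * z ^ m\<close>, then, for \<open>\<rho> = 1\<close>, the test on kernels ensures
that \<open>G(z) = P[|\<beta>|\<^sup>2](z) - |\<beta>(z)|\<^sup>2\<close>, with \<open>P\<close> the Poisson extension, lies between \<open>0\<close> and \<open>1\<close> in the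
disc. It vanishes on the circle, and its Laplacian is \<open>-4 |\<beta>'|\<^sup>2\<close>. For a polynomial \<open>f\<close> and
\<open>v = sqrt (|f|\<^sup>2 + \<epsilon>)\<close> the function \<open>W = (5 + (2 - G)\<^sup>2) v - Re (f * cnj \<beta>)\<close> turns out to be
subharmonic: the terms \<open>v |\<beta>'|\<^sup>2\<close> and \<open>|f'|\<^sup>2 / v\<close> in its Laplacian dominate \<open>4 |f'| |\<beta>'|\<close>. Since
\<open>W(0) \<ge> 0\<close> and \<open>W = 9 v - Re (f * cnj \<beta>)\<close> on the circle, the mean value inequality gives
\<open>Re (\<integral> f * cnj \<beta>) \<le> 9 \<integral> v\<close>.
\<close>

section \<open>Integration over the circle\<close>

abbreviation torus :: "complex set" where "torus \<equiv> sphere 0 1"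

lemma space_circle_measure [simp]: "space circle_measure = torus"
  by (simp add: circle_measure_def space_restrict_space)

lemma cis_measurable: "cis \<in> measurable (uniform_measure lborel {0..<2*pi}) (restrict_space borel torus)"
proof (rule measurable_restrict_space2)
  show "cis \<in> space (uniform_measure lborel {0..<2*pi}) \<rightarrow> torus" by simp
  have "continuous_on UNIV cis" by (intro continuous_intros)
  then show "cis \<in> borel_measurable (uniform_measure lborel {0..<2*pi})"
    using borel_measurable_continuous_onI measurable_cong_sets[of "uniform_measure lborel {0..<2*pi}" borel]
    by (metis sets_lborel sets_uniform_measure)
qed

lemma prob_space_circle_measure: "prob_space circle_measure"
proof -
  interpret prob_space "uniform_measure lborel {0..<2*pi}"
    by (rule prob_space_uniform_measure) auto
  show ?thesis
    unfolding circle_measure_def by (rule prob_space_distr[OF cis_measurable])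
qed

interpretation circle: prob_space circle_measure by (rule prob_space_circle_measure)

lemma continuous_imp_circle_measurable:
  fixes g :: "complex \<Rightarrow> 'a::topological_space"
  assumes "continuous_on torus g" shows "g \<in> borel_measurable circle_measure"
  using borel_measurable_continuous_on_restrict[OF assms] 
  by (simp add: circle_measure_def cong: measurable_cong_sets)

lemma continuous_imp_circle_bounded:
  fixes g :: "complex \<Rightarrow> 'a::real_normed_vector"
  assumes "continuous_on torus g" obtains B where "B > 0" "\<And>z. z \<in> torus \<Longrightarrow> norm (g z) \<le> B"
  using compact_imp_bounded[OF compact_continuous_image[OF assms]] unfolding bounded_pos by auto

lemma continuous_imp_circle_integrable:
  fixes g :: "complex \<Rightarrow> 'a::{second_countable_topology, banach}"
  assumes "continuous_on torus g" shows "integrable circle_measure g"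
proof -
  obtain B where "\<And>z. z \<in> torus \<Longrightarrow> norm (g z) \<le> B"
    using continuous_imp_circle_bounded[OF assms] by blast
  then show ?thesis
    by (intro circle.integrable_const_bound[of _ B] continuous_imp_circle_measurable assms) auto
qed

lemma circle_integral_eq:
  fixes g :: "complex \<Rightarrow> 'a::euclidean_space"
  assumes g: "continuous_on torus g"
  shows "(\<integral>z. g z \<partial>circle_measure) = (1 / (2*pi)) *\<^sub>R integral {0..2*pi} (\<lambda>t. g (cis t))"
proof -
  have cont: "continuous_on S (\<lambda>t. g (cis t))" for S
    by (rule continuous_on_compose2[OF g]) (auto intro!: continuous_intros)
  have m: "g \<in> borel_measurable (restrict_space borel torus)"
    using continuous_imp_circle_measurable[OF g] by (simp add: circle_measure_def cong: measurable_cong_sets)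
  have m': "(\<lambda>t. g (cis t)) \<in> borel_measurable lborel"
    using borel_measurable_continuous_onI[OF cont[of UNIV]] by simp
  have u: "uniform_measure lborel {0..<2*pi} = density lborel (\<lambda>t. ennreal (indicator {0..<2*pi} t / (2*pi)))"
    unfolding uniform_measure_def
    using divide_ennreal[of 1 "2*pi"] by (intro density_cong) (auto simp: indicator_def intro!: AE_I2)
  have "(\<integral>z. g z \<partial>circle_measure) = (\<integral>t. g (cis t) \<partial>uniform_measure lborel {0..<2*pi})"
    unfolding circle_measure_def by (rule integral_distr[OF cis_measurable m])
  also have "\<dots> = (\<integral>t. (indicator {0..<2*pi} t / (2*pi)) *\<^sub>R g (cis t) \<partial>lborel)"
    unfolding u using cont[of UNIV]
    by (intro integral_density) (auto intro: borel_measurable_continuous_onI)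
  also have "\<dots> = (\<integral>t. (1/(2*pi)) *\<^sub>R (indicator {0..2*pi} t *\<^sub>R g (cis t)) \<partial>lborel)"
  proof (rule integral_cong_AE)
    have "AE t in lborel. t \<noteq> 2*pi" by (rule AE_lborel_singleton)
    then show "AE t in lborel. (indicator {0..<2*pi} t / (2*pi)) *\<^sub>R g (cis t)
        = (1/(2*pi)) *\<^sub>R (indicator {0..2*pi} t *\<^sub>R g (cis t))"
      by eventually_elim (auto simp: indicator_def)
  qed (use m' in measurable)
  also have "\<dots> = (1/(2*pi)) *\<^sub>R (LINT t:{0..2*pi}|lborel. g (cis t))"
    unfolding set_lebesgue_integral_def
    by (rule integral_scaleR_right)
  also have "(LINT t:{0..2*pi}|lborel. g (cis t)) = integral {0..2*pi} (\<lambda>t. g (cis t))"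
    by (rule set_borel_integral_eq_integral) (rule borel_integrable_atLeastAtMost'[OF cont])
  finally show ?thesis .
qed

text \<open>
Because of this, averaging the rotations of a function by the \<open>n\<close>-th roots of unity keeps its mean value.
\<close>
lemma circle_integral_rotate:
  fixes g :: "complex \<Rightarrow> 'a::euclidean_space"
  assumes g: "continuous_on torus g" and s: "0 \<le> s" "s \<le> 2*pi"
  shows "(\<integral>z. g (cis s * z) \<partial>circle_measure) = (\<integral>z. g z \<partial>circle_measure)"
proof -
  let ?h = "\<lambda>t. g (cis t)"
  have cont: "continuous_on S ?h" for S
    by (rule continuous_on_compose2[OF g]) (auto intro!: continuous_intros)
  have int: "?h integrable_on {a..b}" for a b by (rule integrable_continuous_real[OF cont])
  have shift: "integral {a..b} (\<lambda>t. ?h (t + c)) = integral {a+c..b+c} ?h" for a b c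
    using integral_shift[OF cont, of a b c] by (simp add: o_def)
  have "continuous_on torus (\<lambda>z. g (cis s * z))"
    by (rule continuous_on_compose2[OF g]) (auto intro!: continuous_intros simp: norm_mult)
  then have "(\<integral>z. g (cis s * z) \<partial>circle_measure) = (1 / (2*pi)) *\<^sub>R integral {0..2*pi} (\<lambda>t. ?h (t + s))"
    by (simp add: circle_integral_eq cis_mult add.commute)
  also have "integral {0..2*pi} (\<lambda>t. ?h (t + s)) = integral {s..2*pi+s} ?h"
    by (simp add: shift)
  also have "\<dots> = integral {s..2*pi} ?h + integral {2*pi..2*pi+s} ?h"
    using s by (intro Henstock_Kurzweil_Integration.integral_combine[symmetric] int) auto
  also have "integral {2*pi..2*pi+s} ?h = integral {0..s} (\<lambda>t. ?h (t + 2*pi))"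
    by (simp add: shift add.commute)
  also have "\<dots> = integral {0..s} ?h"
    by (simp add: cis_mult[symmetric])
  also have "integral {s..2*pi} ?h + integral {0..s} ?h = integral {0..2*pi} ?h"
    using Henstock_Kurzweil_Integration.integral_combine[OF s int] by (simp add: add.commute)
  finally show ?thesis by (simp add: circle_integral_eq g)
qed

text \<open>
Cauchy's formula for the higher derivatives at the centre of a circle of radius \<open>r\<close>. It yields the
orthogonality of the powers as well as the Fourier coefficients of functions in \<open>H\<^sup>2\<close>.
\<close>
lemma Taylor_coefficient_eq_circle_integral:
  assumes F: "F holomorphic_on ball 0 R" and r: "0 < r" "r < R"
  shows "(\<integral>z. F (of_real r * z) * cnj z ^ n \<partial>circle_measure) = of_real (r ^ n) * ((deriv ^^ n) F 0 / fact n)"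
proof -
  have cont: "continuous_on (cball 0 r) F"
    using F r by (intro holomorphic_on_imp_continuous_on holomorphic_on_subset[OF F]) auto
  have ct: "continuous_on torus (\<lambda>z. F (of_real r * z) * cnj z ^ n)"
    using r by (intro continuous_intros continuous_on_compose2[OF cont]) (auto simp: norm_mult)
  have "((\<lambda>u. F u / (u-0) ^ (Suc n)) has_contour_integral ((2 * pi * \<i>) / (fact n) * (deriv ^^ n) F 0)) (circlepath 0 r)"
    using r by (intro Cauchy_has_contour_integral_higher_derivative_circlepath cont holomorphic_on_subset[OF F]) auto
  then have "((\<lambda>t. F (r * cis t) / (r * cis t) ^ Suc n * r * \<i> * cis t) has_integral
      ((2 * pi * \<i>) / (fact n) * (deriv ^^ n) F 0)) {0..2*pi}"
    unfolding circlepath_def by (simp add: has_contour_integral_part_circlepath_iff)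
  then have "((\<lambda>t. (r^n / (2 * pi * \<i>)) * (F (r * cis t) / (r * cis t) ^ Suc n * r * \<i> * cis t)) has_integral
      (r^n / (2 * pi * \<i>)) * ((2 * pi * \<i>) / (fact n) * (deriv ^^ n) F 0)) {0..2*pi}"
    by (rule has_integral_mult_right)
  moreover have "(r^n / (2 * pi * \<i>)) * (F (r * cis t) / (r * cis t) ^ Suc n * r * \<i> * cis t) =
      (1/(2*pi)) *\<^sub>R (F (r * cis t) * cnj (cis t) ^ n)" for t
    using r by (simp add: cis_cnj cis_inverse[symmetric] power_inverse field_simps scaleR_conv_of_real power_mult_distrib)
  ultimately have "((\<lambda>t. (1/(2*pi)) *\<^sub>R (F (r * cis t) * cnj (cis t) ^ n)) has_integral
      (r^n / (2 * pi * \<i>)) * ((2 * pi * \<i>) / (fact n) * (deriv ^^ n) F 0)) {0..2*pi}"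
    by simp
  then have "integral {0..2*pi} (\<lambda>t. (1/(2*pi)) *\<^sub>R (F (r * cis t) * cnj (cis t) ^ n)) 
      = r ^ n * ((deriv ^^ n) F 0 / fact n)"
    by (subst integral_unique) (auto simp: field_simps)
  then show ?thesis
    by (subst circle_integral_eq[OF ct]) simp
qed

lemma circle_integral_power_mult_holomorphic:
  assumes F: "F holomorphic_on ball 0 R" and r: "0 < r" "r < R" and n: "n \<ge> 1"
  shows "(\<integral>z. F (of_real r * z) * z ^ n \<partial>circle_measure) = 0"
proof -
  have "(\<lambda>z. F z * (z / r) ^ n) holomorphic_on ball 0 R"
    using r by (intro holomorphic_intros F) auto
  from Taylor_coefficient_eq_circle_integral[OF this r, of 0] show ?thesis using r n by simp
qed

lemma torus_cnj_power_cancel: "z \<in> torus \<Longrightarrow> z ^ k * cnj z ^ k = 1"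
  by (simp flip: power_mult_distrib complex_norm_square)

lemma circle_orthogonality:
  "(\<integral>z. z ^ i * cnj z ^ j \<partial>circle_measure) = (if i = j then 1 else 0)"
proof -
  have pos: "(\<integral>z. z ^ k \<partial>circle_measure) = (if k = 0 then 1 else 0)" for k
    using circle_integral_power_mult_holomorphic[of "\<lambda>_. 1" 2 1 k] circle.prob_space by (cases k) auto
  have *: "z ^ i * cnj z ^ j = (if j \<le> i then z ^ (i - j) else cnj (z ^ (j - i)))" if "z \<in> torus" for z i j
  proof -
    from torus_cnj_power_cancel[OF that] have "z ^ (k + l) * cnj z ^ k = z ^ l" "z ^ k * cnj z ^ (k + l) = cnj z ^ l" for k l
      by (simp_all add: power_add mult_ac)
    from this(1)[of j "i - j"] this(2)[of i "j - i"] show ?thesis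
      by (cases "j \<le> i") simp_all
  qed
  have "(\<integral>z. z ^ i * cnj z ^ j \<partial>circle_measure) = 
     (\<integral>z. (if j \<le> i then z ^ (i - j) else cnj (z ^ (j - i))) \<partial>circle_measure)"
    by (rule Bochner_Integration.integral_cong) (auto simp: *)
  also have "\<dots> = (if i = j then 1 else 0)"
    by (cases "j \<le> i") (auto simp: pos simp del: complex_cnj_power)
  finally show ?thesis .
qed

lemma circle_inner_polynomials:
  assumes "finite A" "finite B"
  shows "(\<integral>z. (\<Sum>i\<in>A. p i * z ^ i) * cnj (\<Sum>j\<in>B. q j * z ^ j) \<partial>circle_measure) = (\<Sum>i\<in>A \<inter> B. p i * cnj (q i))"
proof -
  have int: "integrable circle_measure (\<lambda>z. (p i * cnj (q j)) * (z ^ i * cnj z ^ j))" for i j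
    by (intro continuous_imp_circle_integrable continuous_intros)
  have "(\<integral>z. (\<Sum>i\<in>A. p i * z ^ i) * cnj (\<Sum>j\<in>B. q j * z ^ j) \<partial>circle_measure)
      = (\<integral>z. (\<Sum>i\<in>A. \<Sum>j\<in>B. (p i * cnj (q j)) * (z ^ i * cnj z ^ j)) \<partial>circle_measure)"
    by (simp add: sum_product mult_ac)
  also have "\<dots> = (\<Sum>i\<in>A. \<Sum>j\<in>B. (p i * cnj (q j)) * (\<integral>z. z ^ i * cnj z ^ j \<partial>circle_measure))"
    using int by simp
  also have "\<dots> = (\<Sum>i\<in>A. \<Sum>j\<in>B. if i = j then p i * cnj (q i) else 0)"
    unfolding circle_orthogonality by (intro sum.cong) auto
  also have "\<dots> = (\<Sum>i\<in>A. if i \<in> B then p i * cnj (q i) else 0)"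
    using assms by (simp add: sum.delta)
  also have "\<dots> = (\<Sum>i\<in>A \<inter> B. p i * cnj (q i))"
    using assms by (simp add: sum.inter_restrict)
  finally show ?thesis .
qed

section \<open>The mean value inequality for smooth subharmonic functions\<close>

definition second_deriv_along :: "(complex \<Rightarrow> real) \<Rightarrow> complex \<Rightarrow> complex \<Rightarrow> real \<Rightarrow> bool" where
  "second_deriv_along u z d s \<longleftrightarrow>
     (\<exists>u'. (\<forall>t. ((\<lambda>t. u (z + of_real t * d)) has_real_derivative u' t) (at t)) \<and>
           (u' has_real_derivative s) (at 0))"

text \<open>
For twice differentiable functions the sum of the second derivatives in two orthogonal unit directions is
the Laplacian. All orthogonal pairs are mentioned in order that the notion be visibly invariant under
rotations.
\<close>
definition subharmonic_on :: "complex set \<Rightarrow> (complex \<Rightarrow> real) \<Rightarrow> bool" where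
  "subharmonic_on S u \<longleftrightarrow>
     (\<forall>z\<in>S. \<forall>d. norm d = 1 \<longrightarrow>
        (\<exists>p q. second_deriv_along u z d p \<and> second_deriv_along u z (\<i> * d) q \<and> p + q \<ge> 0))"

lemma second_deriv_nonpos_at_max:
  fixes u :: "real \<Rightarrow> real"
  assumes u: "\<And>t. (u has_real_derivative u' t) (at t)" and u': "(u' has_real_derivative s) (at 0)"
    and max: "\<And>t. \<bar>t\<bar> < e \<Longrightarrow> u t \<le> u 0" and e: "e > 0"
  shows "s \<le> 0"
proof (rule ccontr)
  assume "\<not> s \<le> 0"
  have "u' 0 = 0"
    by (rule DERIV_local_max[OF u e]) (use max in auto)
  obtain d where d: "d > 0" "\<And>h. 0 < h \<Longrightarrow> h < d \<Longrightarrow> u' 0 < u' h"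
    using DERIV_pos_inc_right[OF u'] \<open>\<not> s \<le> 0\<close> by auto
  define h where "h = min d e / 2"
  have h: "0 < h" "h < d" "h < e" using d e by (auto simp: h_def)
  obtain x where "0 < x" "x < h" "u h - u 0 = (h - 0) * u' x"
    using MVT2[of 0 h u u'] h u by auto
  with d(2)[of x] h \<open>u' 0 = 0\<close> have "u h > u 0" by (smt (verit) mult_pos_pos)
  with max[of h] h show False by auto
qed

lemma second_deriv_along_add:
  "second_deriv_along u z d p \<Longrightarrow> second_deriv_along v z d q \<Longrightarrow>
   second_deriv_along (\<lambda>z. u z + v z) z d (p + q)"
  unfolding second_deriv_along_def
proof (elim exE conjE)
  fix u' v' assume "\<forall>t. ((\<lambda>t. u (z + of_real t * d)) has_real_derivative u' t) (at t)"
    "\<forall>t. ((\<lambda>t. v (z + of_real t * d)) has_real_derivative v' t) (at t)"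
    "(u' has_real_derivative p) (at 0)" "(v' has_real_derivative q) (at 0)"
  then show "\<exists>w'. (\<forall>t. ((\<lambda>t. u (z + of_real t * d) + v (z + of_real t * d)) has_real_derivative w' t) (at t))
      \<and> (w' has_real_derivative p + q) (at 0)"
    by (intro exI[of _ "\<lambda>t. u' t + v' t"]) (auto intro!: DERIV_add)
qed

lemma second_deriv_along_cmult:
  "second_deriv_along u z d p \<Longrightarrow> second_deriv_along (\<lambda>z. c * u z) z d (c * p)"
  unfolding second_deriv_along_def
proof (elim exE conjE)
  fix u' assume "\<forall>t. ((\<lambda>t. u (z + of_real t * d)) has_real_derivative u' t) (at t)"
    "(u' has_real_derivative p) (at 0)"
  then show "\<exists>w'. (\<forall>t. ((\<lambda>t. c * u (z + of_real t * d)) has_real_derivative w' t) (at t))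
      \<and> (w' has_real_derivative c * p) (at 0)"
    by (intro exI[of _ "\<lambda>t. c * u' t"]) (auto intro!: DERIV_cmult)
qed

lemma second_deriv_along_rotate:
  "second_deriv_along u (w * z) (w * d) p \<Longrightarrow> second_deriv_along (\<lambda>z. u (w * z)) z d p"
  unfolding second_deriv_along_def by (simp add: algebra_simps)

lemma subharmonic_on_cmult:
  "subharmonic_on S u \<Longrightarrow> c \<ge> 0 \<Longrightarrow> subharmonic_on S (\<lambda>z. c * u z)"
  unfolding subharmonic_on_def
  by (metis second_deriv_along_cmult distrib_left mult_nonneg_nonneg)

lemma subharmonic_on_add:
  assumes "subharmonic_on S u" "subharmonic_on S v"
  shows "subharmonic_on S (\<lambda>z. u z + v z)"
  unfolding subharmonic_on_def
proof (intro ballI allI impI)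
  fix z d :: complex assume z: "z \<in> S" "norm d = 1"
  obtain p q where 1: "second_deriv_along u z d p" "second_deriv_along u z (\<i> * d) q" "p + q \<ge> 0"
    using assms(1) z unfolding subharmonic_on_def by blast
  obtain p' q' where 2: "second_deriv_along v z d p'" "second_deriv_along v z (\<i> * d) q'" "p' + q' \<ge> 0"
    using assms(2) z unfolding subharmonic_on_def by blast
  have "(p + p') + (q + q') \<ge> 0" using 1 2 by simp
  then show "\<exists>p q. second_deriv_along (\<lambda>z. u z + v z) z d p
      \<and> second_deriv_along (\<lambda>z. u z + v z) z (\<i> * d) q \<and> p + q \<ge> 0"
    using second_deriv_along_add 1 2 by blast
qed

lemma subharmonic_on_const: "subharmonic_on S (\<lambda>z. 0)"
  unfolding subharmonic_on_def second_deriv_along_def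
  by (metis DERIV_const add_0 order_refl)

lemma subharmonic_on_sum:
  assumes "\<And>x. x \<in> A \<Longrightarrow> subharmonic_on S (u x)"
  shows "subharmonic_on S (\<lambda>z. \<Sum>x\<in>A. u x z)"
  using assms by (induction A rule: infinite_finite_induct) (auto intro: subharmonic_on_add subharmonic_on_const)

lemma subharmonic_on_rotate:
  assumes "subharmonic_on (ball 0 1) u" "norm w = 1"
  shows "subharmonic_on (ball 0 1) (\<lambda>z. u (w * z))"
  unfolding subharmonic_on_def
proof (intro ballI allI impI)
  fix z d :: complex assume z: "z \<in> ball 0 1" "norm d = 1"
  then have "w * z \<in> ball 0 1" "norm (w * d) = 1" using assms(2) by (auto simp: norm_mult)
  then obtain p q where "second_deriv_along u (w*z) (w*d) p" "second_deriv_along u (w*z) (\<i> * (w*d)) q" "p + q \<ge> 0"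
    using assms(1) unfolding subharmonic_on_def by blast
  then show "\<exists>p q. second_deriv_along (\<lambda>z. u (w*z)) z d p
      \<and> second_deriv_along (\<lambda>z. u (w*z)) z (\<i> * d) q \<and> p + q \<ge> 0"
    using second_deriv_along_rotate[of u w z d] second_deriv_along_rotate[of u w z "\<i> * d"]
    by (metis mult.left_commute)
qed

text \<open>
Adding \<open>\<delta> * |z|\<^sup>2\<close> makes the Laplacian strictly positive, and then a maximum cannot lie in the open disc,
where both second derivatives would have to be nonpositive.
\<close>
lemma subharmonic_max_principle:
  assumes u: "subharmonic_on (ball 0 1) u" "continuous_on (cball 0 1) u"
    and B: "\<And>z. z \<in> torus \<Longrightarrow> u z \<le> B"
  shows "u 0 \<le> B"
proof (rule field_le_epsilon)
  fix \<delta> :: real assume \<delta>: "\<delta> > 0"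
  define v where "v = (\<lambda>z. u z + \<delta> * (norm z)\<^sup>2)"
  have "continuous_on (cball 0 1) v" unfolding v_def by (intro continuous_intros u(2))
  then obtain z where z: "z \<in> cball 0 1" "\<And>w. w \<in> cball 0 1 \<Longrightarrow> v w \<le> v z"
    using continuous_attains_sup[of "cball (0::complex) 1" v] by fastforce
  have sq: "second_deriv_along (\<lambda>z. \<delta> * (norm z)\<^sup>2) z d (2 * \<delta>)" if "norm d = 1" for d
  proof -
    have n: "Re d * Re d + Im d * Im d = 1" 
      using that by (simp add: cmod_def power2_eq_square)
    have "((\<lambda>t. 2 * \<delta> * (Re z * Re d + Im z * Im d + t)) has_real_derivative 2 * \<delta>) (at 0)"
      by (auto intro!: derivative_eq_intros)
    moreover have "(norm (z + of_real t * d))\<^sup>2 = (norm z)\<^sup>2 + 2 * t * (Re z * Re d + Im z * Im d) + t\<^sup>2" for t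
    proof -
      have "(norm (z + of_real t * d))\<^sup>2 = (Re z + t * Re d)\<^sup>2 + (Im z + t * Im d)\<^sup>2" by (simp add: cmod_power2)
      also have "\<dots> = (Re z)\<^sup>2 + (Im z)\<^sup>2 + 2 * t * (Re z * Re d + Im z * Im d) + t\<^sup>2 * (Re d * Re d + Im d * Im d)"
        by algebra
      finally show ?thesis using n by (simp add: cmod_power2)
    qed
    ultimately show ?thesis unfolding second_deriv_along_def
      by (intro exI[of _ "\<lambda>t. 2 * \<delta> * (Re z * Re d + Im z * Im d + t)"])
         (auto intro!: derivative_eq_intros simp: algebra_simps)
  qed
  have "norm z = 1"
  proof (rule ccontr)
    assume "norm z \<noteq> 1"
    then have zb: "z \<in> ball 0 1" using z(1) by auto
    then obtain p q where pq: "second_deriv_along u z 1 p" "second_deriv_along u z (\<i> * 1) q" "p + q \<ge> 0"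
      using u(1) unfolding subharmonic_on_def by (metis norm_one)
    have np: "s \<le> 0" if s: "second_deriv_along v z d s" "norm d = 1" for s d
    proof -
      obtain u' where u': "\<And>t. ((\<lambda>t. v (z + of_real t * d)) has_real_derivative u' t) (at t)"
          "(u' has_real_derivative s) (at 0)"
        using s(1) unfolding second_deriv_along_def by blast
      show ?thesis
      proof (rule second_deriv_nonpos_at_max[OF u'])
        show "1 - norm z > 0" using zb by simp
        fix t :: real assume "\<bar>t\<bar> < 1 - norm z"
        then have "z + of_real t * d \<in> cball 0 1"
          using norm_triangle_ineq[of z "of_real t * d"] s(2) by (simp add: norm_mult)
        then show "v (z + of_real t * d) \<le> v (z + of_real 0 * d)" using z(2) by simp
      qed
    qed
    have "p + 2 * \<delta> \<le> 0" 
      using np[of 1 "p + 2*\<delta>"] second_deriv_along_add[OF pq(1) sq[of 1]] by (simp add: v_def)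
    moreover have "q + 2 * \<delta> \<le> 0" 
      using np[of "\<i>*1" "q + 2*\<delta>"] second_deriv_along_add[OF pq(2) sq[of "\<i>*1"]] by (simp add: v_def)
    ultimately show False using pq(3) \<delta> by linarith
  qed
  moreover have "v 0 \<le> v z" using z(2) by simp
  ultimately show "u 0 \<le> B + \<delta>" using B[of z] by (simp add: v_def)
qed

lemma ex_nth_root_close:
  assumes "z \<in> torus" "w \<in> torus" "n \<ge> (1::nat)"
  shows "\<exists>x<n. dist (cis (2 * pi * real x / n) * z) w \<le> 2 * pi / n"
proof -
  define \<theta> where "\<theta> = Arg2pi (w / z)"
  have wz: "w = cis \<theta> * z" and \<theta>: "0 \<le> \<theta>" "\<theta> < 2*pi"
    using Arg2pi_eq[of "w / z"] Arg2pi_ge_0[of "w/z"] Arg2pi_lt_2pi[of "w/z"] assms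
    by (auto simp: \<theta>_def norm_divide cis_conv_exp)
  define x where "x = nat \<lfloor>\<theta> * n / (2*pi)\<rfloor>"
  have "\<theta> * n / (2*pi) \<ge> 0" using \<theta> by simp
  then have x: "real x \<le> \<theta> * n / (2*pi)" "\<theta> * n / (2*pi) < real x + 1"
    unfolding x_def by linarith+
  then have x': "2 * pi * real x / n \<le> \<theta>" "\<theta> < 2 * pi * real x / n + 2 * pi / n"
    using assms(3) by (auto simp: field_simps)
  have "x < n"
  proof -
    have "\<theta> * n / (2*pi) < n" using \<theta> assms(3) by (auto simp: field_simps)
    with x show ?thesis by linarith
  qed
  moreover have "dist (cis (2 * pi * real x / n) * z) w \<le> 2 * pi / n"
  proof -
    have "dist (cis (2 * pi * real x / n) * z) w = norm (cis (2 * pi * real x / n) - cis \<theta>)"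
      using assms wz by (simp add: dist_norm norm_mult flip: left_diff_distrib)
    also have "\<dots> = norm (cis (2 * pi * real x / n) * (1 - cis (\<theta> - 2 * pi * real x / n)))"
      by (simp add: right_diff_distrib cis_mult)
    also have "\<dots> = norm (exp (\<i> * of_real (\<theta> - 2 * pi * real x / n)) - 1)"
      by (simp add: norm_mult norm_minus_commute cis_conv_exp)
    also have "\<dots> \<le> \<bar>\<theta> - 2 * pi * real x / n\<bar>"
      using abs_sin_x_le_abs_x[of "(\<theta> - 2 * pi * real x / n) / 2"] by (simp only: dist_exp_i_1) simp
    also have "\<dots> \<le> 2 * pi / n" using x' by linarith
    finally show ?thesis .
  qed
  ultimately show ?thesis by blast
qed

text \<open>
The average \<open>W\<close> of the rotations of \<open>u\<close> by the \<open>n\<close>-th roots of unity is again subharmonic, it has the same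
mean over the circle and the same value at the centre, and for large \<open>n\<close> it is nearly constant on the
circle. So the maximum principle for \<open>W\<close> gives the mean value inequality for \<open>u\<close>.
\<close>
lemma subharmonic_le_circle_integral:
  assumes u: "subharmonic_on (ball 0 1) u" "continuous_on (cball 0 1) u"
  shows "u 0 \<le> (\<integral>z. u z \<partial>circle_measure)"
proof (rule field_le_epsilon)
  fix \<epsilon> :: real assume \<epsilon>: "\<epsilon> > 0"
  have cT: "continuous_on torus u" by (rule continuous_on_subset[OF u(2)]) auto
  have "uniformly_continuous_on torus u" 
    by (rule compact_uniformly_continuous[OF cT]) simp
  then obtain \<delta> where \<delta>: "\<delta> > 0" 
      "\<And>z w. z \<in> torus \<Longrightarrow> w \<in> torus \<Longrightarrow> dist w z < \<delta> \<Longrightarrow> dist (u w) (u z) < \<epsilon>"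
    using \<epsilon> unfolding uniformly_continuous_on_def by metis
  obtain n :: nat where "2 * pi / \<delta> < n" using reals_Archimedean2 by blast
  moreover have "0 < 2 * pi / \<delta>" using \<delta> by simp
  ultimately have n: "n \<ge> 1" "2 * pi / n < \<delta>" using \<delta>(1)
    by (cases n; simp add: field_simps)+
  let ?\<omega> = "\<lambda>x. cis (2 * pi * real x / n)"
  define W where "W = (\<lambda>z. (1/n) * (\<Sum>x<n. u (?\<omega> x * z)))"
  have subW: "subharmonic_on (ball 0 1) W"
    unfolding W_def by (intro subharmonic_on_cmult subharmonic_on_sum subharmonic_on_rotate u) auto
  have contW: "continuous_on (cball 0 1) W"
    unfolding W_def
    by (intro continuous_intros continuous_on_compose2[OF u(2)]) (auto simp: norm_mult)
  have intu: "(\<integral>z. u (?\<omega> x * z) \<partial>circle_measure) = (\<integral>z. u z \<partial>circle_measure)" if "x < n" for x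
    using that n by (intro circle_integral_rotate cT) (auto simp: field_simps)
  have intW: "(\<integral>z. W z \<partial>circle_measure) = (\<integral>z. u z \<partial>circle_measure)"
  proof -
    have "integrable circle_measure (\<lambda>z. u (?\<omega> x * z))" for x
      by (intro continuous_imp_circle_integrable continuous_on_compose2[OF cT]) (auto intro!: continuous_intros simp: norm_mult)
    then have "(\<integral>z. W z \<partial>circle_measure) = (1/n) * (\<Sum>x<n. \<integral>z. u (?\<omega> x * z) \<partial>circle_measure)"
      unfolding W_def by simp
    also have "\<dots> = (\<integral>z. u z \<partial>circle_measure)" using intu n by simp
    finally show ?thesis .
  qed
  have rotW: "W (?\<omega> x * z) = W z" for x z
  proof -
    have add: "?\<omega> (a + b) = ?\<omega> a * ?\<omega> b" for a b
      by (simp add: cis_mult add_divide_distrib distrib_left)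
    have add': "?\<omega> (a + b) * z = ?\<omega> a * (?\<omega> b * z)" for a b z
      by (subst add) (rule mult.assoc)
    have per: "?\<omega> (y + n) = ?\<omega> y" for y
      using n by (simp add: add_divide_distrib distrib_left flip: cis_mult)
    have step: "(\<Sum>x<n. u (?\<omega> (Suc x) * z)) = (\<Sum>x<n. u (?\<omega> x * z))" for z
    proof -
      have "(\<Sum>x<n. u (?\<omega> (Suc x) * z)) + u (?\<omega> 0 * z) = (\<Sum>x<Suc n. u (?\<omega> x * z))"
        by (subst sum.lessThan_Suc_shift) (simp add: add.commute)
      also have "\<dots> = (\<Sum>x<n. u (?\<omega> x * z)) + u (?\<omega> 0 * z)"
        using per[of 0] by simp
      finally show ?thesis by simp
    qed
    have "(\<Sum>y<n. u (?\<omega> (y + x) * z)) = (\<Sum>y<n. u (?\<omega> y * z))"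
    proof (induction x arbitrary: z)
      case (Suc x)
      have "(\<Sum>y<n. u (?\<omega> (y + Suc x) * z)) = (\<Sum>y<n. u (?\<omega> (Suc y) * (?\<omega> x * z)))"
        by (intro sum.cong refl) (simp only: add[symmetric] mult.assoc[symmetric] add_Suc add_Suc_right)
      also have "\<dots> = (\<Sum>y<n. u (?\<omega> y * (?\<omega> x * z)))" by (rule step)
      also have "\<dots> = (\<Sum>y<n. u (?\<omega> (y + x) * z))" by (simp only: add')
      finally show ?case using Suc by simp
    qed simp
    then show ?thesis unfolding W_def by (simp only: add')
  qed
  have close: "W z \<le> W w + \<epsilon>" if zw: "z \<in> torus" "w \<in> torus" for z w
  proof -
    obtain x where x: "x < n" "dist (?\<omega> x * z) w \<le> 2 * pi / n" using ex_nth_root_close[OF zw n(1)] by blast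
    have "u (?\<omega> y * (?\<omega> x * z)) \<le> u (?\<omega> y * w) + \<epsilon>" for y
    proof -
      have "dist (?\<omega> y * (?\<omega> x * z)) (?\<omega> y * w) = dist (?\<omega> x * z) w"
        by (simp add: dist_norm norm_mult flip: right_diff_distrib)
      then have "dist (u (?\<omega> y * (?\<omega> x * z))) (u (?\<omega> y * w)) < \<epsilon>"
        using x n zw by (intro \<delta>(2)) (auto simp: norm_mult)
      then show ?thesis by (simp add: dist_real_def)
    qed
    then have "(\<Sum>y<n. u (?\<omega> y * (?\<omega> x * z))) \<le> (\<Sum>y<n. u (?\<omega> y * w) + \<epsilon>)"
      by (intro sum_mono)
    then have "W (?\<omega> x * z) \<le> W w + \<epsilon>"
      unfolding W_def using n by (simp add: sum.distrib field_simps)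
    then show ?thesis by (simp add: rotW)
  qed
  have "W z \<le> (\<integral>z. u z \<partial>circle_measure) + \<epsilon>" if z: "z \<in> torus" for z
  proof -
    have i: "integrable circle_measure W"
      by (rule continuous_imp_circle_integrable[OF continuous_on_subset[OF contW]]) auto
    have "(\<integral>w. W z \<partial>circle_measure) \<le> (\<integral>w. W w + \<epsilon> \<partial>circle_measure)"
    proof (rule integral_mono)
      show "integrable circle_measure (\<lambda>w. W z)" by simp
      show "integrable circle_measure (\<lambda>w. W w + \<epsilon>)" using i by simp
      show "W z \<le> W w + \<epsilon>" if "w \<in> space circle_measure" for w
        using close[OF z, of w] that by simp
    qed
    also have "(\<integral>w. W w + \<epsilon> \<partial>circle_measure) = (\<integral>z. u z \<partial>circle_measure) + \<epsilon>"
      using i circle.prob_space by (subst Bochner_Integration.integral_add) (simp_all add: intW)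
    finally show ?thesis using circle.prob_space by simp
  qed
  then have "W 0 \<le> (\<integral>z. u z \<partial>circle_measure) + \<epsilon>"
    by (rule subharmonic_max_principle[OF subW contW])
  then show "u 0 \<le> (\<integral>z. u z \<partial>circle_measure) + \<epsilon>" using n by (simp add: W_def)
qed

section \<open>A subharmonic test function\<close>

text \<open>
The algebra behind subharmonicity. Here \<open>f = p + \<i> q\<close> and \<open>v\<^sup>2 = |f|\<^sup>2 + e\<close>; \<open>P + \<i> Q\<close> and \<open>X + \<i> Y\<close> stand for
\<open>f'\<close> and \<open>\<beta>'\<close> (times a unit direction), \<open>(ga, gb)\<close> for the gradient of \<open>G\<close>, \<open>u\<close> for \<open>2 - G\<close>,
\<open>(v1a, v1b)\<close> and \<open>L\<close> for gradient and Laplacian of \<open>v\<close>. The key facts are \<open>|\<nabla>v|\<^sup>2 \<le> |f'|\<^sup>2 \<le> v L\<close>. The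
mixed term \<open>-4u \<nabla>G \<nabla>v\<close> is absorbed by completing the square with \<open>2 v |\<nabla>G|\<^sup>2\<close>, at the cost of
\<open>2 u\<^sup>2 |f'|\<^sup>2 / v\<close>. As \<open>u\<^sup>2 \<le> 4\<close>, the constant \<open>5\<close> leaves \<open>|f'|\<^sup>2 / v\<close>, and with
\<open>8 v |\<beta>'|\<^sup>2\<close> this dominates \<open>4 |f'| |\<beta>'|\<close>.
\<close>
lemma test_function_laplacian_nonneg:
  fixes p q x y P Q X Y ga gb v u e :: real
  assumes v: "v > 0" "v\<^sup>2 = p\<^sup>2 + q\<^sup>2 + e" "e > 0" and u: "1 \<le> u" "u \<le> 2"
  defines "v1a \<equiv> (p*P + q*Q) / v" and "v1b \<equiv> (q*P - p*Q) / v"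
    and "L \<equiv> 2 * (P\<^sup>2 + Q\<^sup>2) / v - ((p*P + q*Q)\<^sup>2 + (q*P - p*Q)\<^sup>2) / v ^ 3"
  shows "(5 + u\<^sup>2) * L - 4 * u * (ga * v1a + gb * v1b) + 2 * (ga\<^sup>2 + gb\<^sup>2) * v
      + 8 * u * (X\<^sup>2 + Y\<^sup>2) * v - 4 * (P * X + Q * Y) \<ge> 0"
proof -
  define F where "F = P\<^sup>2 + Q\<^sup>2"
  have id: "(p*P + q*Q)\<^sup>2 + (q*P - p*Q)\<^sup>2 = (p\<^sup>2 + q\<^sup>2) * F"
    unfolding F_def by algebra
  have F: "F \<ge> 0" "(p\<^sup>2 + q\<^sup>2) * F \<le> v\<^sup>2 * F"
    using v by (auto simp: F_def intro!: mult_right_mono)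
  define k where "k = F / v"
  have L: "L \<ge> k"
  proof -
    have "((p*P + q*Q)\<^sup>2 + (q*P - p*Q)\<^sup>2) / v ^ 3 \<le> (v\<^sup>2 * F) / v ^ 3"
      unfolding id using F v by (intro divide_right_mono) auto
    also have "\<dots> = F / v" using v(1) by (simp add: power2_eq_square power3_eq_cube)
    finally show ?thesis unfolding L_def k_def F_def by (simp add: add_divide_distrib algebra_simps)
  qed
  have g: "v1a\<^sup>2 + v1b\<^sup>2 \<le> F"
  proof -
    have "v1a\<^sup>2 + v1b\<^sup>2 = ((p\<^sup>2 + q\<^sup>2) * F) / v\<^sup>2"
      unfolding v1a_def v1b_def id[symmetric] by (simp only: power_divide add_divide_distrib[of _ _ "v\<^sup>2"])
    also have "\<dots> \<le> F" using F v(1) by (simp add: pos_divide_le_eq mult.commute)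
    finally show ?thesis .
  qed
  have "- 4 * u * (ga * v1a + gb * v1b) + 2 * (ga\<^sup>2 + gb\<^sup>2) * v
      = 2 * v * ((ga - u * v1a / v)\<^sup>2 + (gb - u * v1b / v)\<^sup>2) - 2 * u\<^sup>2 * (v1a\<^sup>2 + v1b\<^sup>2) / v"
    using v(1) by (simp add: power2_eq_square field_simps)
  moreover have "0 \<le> 2 * v * ((ga - u * v1a / v)\<^sup>2 + (gb - u * v1b / v)\<^sup>2)" using v(1) by simp
  moreover have "2 * u\<^sup>2 * (v1a\<^sup>2 + v1b\<^sup>2) / v \<le> 2 * u\<^sup>2 * k"
    using mult_left_mono[OF g, of "2 * u\<^sup>2"] v(1) by (simp add: k_def divide_right_mono)
  ultimately have 1: "- 4 * u * (ga * v1a + gb * v1b) + 2 * (ga\<^sup>2 + gb\<^sup>2) * v \<ge> - (2 * u\<^sup>2 * k)"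
    by linarith
  have 2: "(5 + u\<^sup>2) * L \<ge> (5 + u\<^sup>2) * k"
    using L by (intro mult_left_mono) auto
  have "u\<^sup>2 \<le> 2\<^sup>2" using u by (intro power_mono) auto
  then have 3: "0 \<le> (4 - u\<^sup>2) * k" unfolding k_def using F(1) v(1) by (intro mult_nonneg_nonneg) auto
  have 4: "8 * (X\<^sup>2 + Y\<^sup>2) * v \<le> 8 * u * (X\<^sup>2 + Y\<^sup>2) * v"
    using u v(1) by (intro mult_right_mono) (auto simp: mult_le_cancel_right1)
  have "k + 8 * (X\<^sup>2 + Y\<^sup>2) * v - 4 * (P * X + Q * Y) 
     = ((P - 2 * X * v)\<^sup>2 + (Q - 2 * Y * v)\<^sup>2) / v + 4 * (X\<^sup>2 + Y\<^sup>2) * v"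
    unfolding k_def F_def using v(1) by (simp add: power2_eq_square field_simps)
  moreover have "\<dots> \<ge> 0" using v(1) by simp
  ultimately show ?thesis using 1 2 3 4 by (simp add: algebra_simps)
qed

lemma DERIV_Re_Im_along:
  assumes "(f has_field_derivative f') (at (z + of_real t * d))"
  shows "((\<lambda>t. Re (f (z + of_real t * d))) has_real_derivative Re (d * f')) (at t)"
    "((\<lambda>t. Im (f (z + of_real t * d))) has_real_derivative Im (d * f')) (at t)"
proof -
  have "((\<lambda>t. z + of_real t * d) has_vector_derivative d) (at t)"
    by (auto intro!: derivative_eq_intros simp: has_vector_derivative_def scaleR_conv_of_real)
  then have "((\<lambda>t. f (z + of_real t * d)) has_vector_derivative d * f') (at t)"
    using field_vector_diff_chain_at[of "\<lambda>t. z + of_real t * d" d t f f'] assms by (simp add: o_def)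
  then show "((\<lambda>t. Re (f (z + of_real t * d))) has_real_derivative Re (d * f')) (at t)"
    "((\<lambda>t. Im (f (z + of_real t * d))) has_real_derivative Im (d * f')) (at t)"
    by (auto simp: has_vector_derivative_complex_iff)
qed

text \<open>
In the application, \<open>Re h\<close> is the harmonic extension of \<open>|b|\<^sup>2\<close> from the circle. The second derivatives
\<open>f2, b2, h2\<close> enter linearly with the factor \<open>d\<^sup>2\<close>, so they cancel between \<open>d\<close> and \<open>\<i> * d\<close>.
\<close>
lemma second_deriv_along_test_function:
  fixes f b h :: "complex \<Rightarrow> complex"
  assumes f: "\<And>z. (f has_field_derivative f1 z) (at z)" "\<And>z. (f1 has_field_derivative f2 z) (at z)"
    and b: "\<And>z. (b has_field_derivative b1 z) (at z)" "\<And>z. (b1 has_field_derivative b2 z) (at z)"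
    and h: "\<And>z. (h has_field_derivative h1 z) (at z)" "\<And>z. (h1 has_field_derivative h2 z) (at z)"
    and e: "e > 0"
  defines "G \<equiv> \<lambda>z. Re (h z) - (norm (b z))\<^sup>2" and "v \<equiv> \<lambda>z. sqrt ((norm (f z))\<^sup>2 + e)"
  assumes ga: "ga = Re (d * h1 z) - 2 * (Re (b z) * Re (d * b1 z) + Im (b z) * Im (d * b1 z))"
    and v1a: "v1a = (Re (f z) * Re (d * f1 z) + Im (f z) * Im (d * f1 z)) / v z"
  shows "second_deriv_along (\<lambda>z. (5 + (2 - G z)\<^sup>2) * v z - Re (f z * cnj (b z))) z d
    ((5 + (2 - G z)\<^sup>2) * (((Re (d * f1 z))\<^sup>2 + (Im (d * f1 z))\<^sup>2 + 
         (Re (f z) * Re (d\<^sup>2 * f2 z) + Im (f z) * Im (d\<^sup>2 * f2 z))) / v z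
       - (Re (f z) * Re (d * f1 z) + Im (f z) * Im (d * f1 z))\<^sup>2 / v z ^ 3)
     - 4 * (2 - G z) * (ga * v1a) + 2 * ga\<^sup>2 * v z
     - 2 * (2 - G z) * v z * (Re (d\<^sup>2 * h2 z) - 2 * ((Re (d * b1 z))\<^sup>2 + (Im (d * b1 z))\<^sup>2 + 
         (Re (b z) * Re (d\<^sup>2 * b2 z) + Im (b z) * Im (d\<^sup>2 * b2 z))))
     - (2 * (Re (d * f1 z) * Re (d * b1 z) + Im (d * f1 z) * Im (d * b1 z)) + 
        (Re (f z) * Re (d\<^sup>2 * b2 z) + Im (f z) * Im (d\<^sup>2 * b2 z)) +
        (Re (b z) * Re (d\<^sup>2 * f2 z) + Im (b z) * Im (d\<^sup>2 * f2 z))))"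
proof -
  let ?l = "\<lambda>t. z + of_real t * d"
  define p where "p t = Re (f (?l t))" for t
  define q where "q t = Im (f (?l t))" for t
  define p1 where "p1 t = Re (d * f1 (?l t))" for t
  define q1 where "q1 t = Im (d * f1 (?l t))" for t
  define x where "x t = Re (b (?l t))" for t
  define y where "y t = Im (b (?l t))" for t
  define x1 where "x1 t = Re (d * b1 (?l t))" for t
  define y1 where "y1 t = Im (d * b1 (?l t))" for t
  define k where "k t = Re (h (?l t))" for t
  define k1 where "k1 t = Re (d * h1 (?l t))" for t
  note defs = p_def q_def p1_def q1_def x_def y_def x1_def y1_def k_def k1_def
  have sc: "((\<lambda>z. d * g z) has_field_derivative d * g' z) (at z)" 
    if "\<And>z. (g has_field_derivative g' z) (at z)" for g g' :: "complex \<Rightarrow> complex" and z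
    using that by (auto intro!: derivative_eq_intros)
  have D [derivative_intros]: 
    "(p has_real_derivative p1 t) (at t)" "(q has_real_derivative q1 t) (at t)" 
    "(x has_real_derivative x1 t) (at t)" "(y has_real_derivative y1 t) (at t)" 
    "(k has_real_derivative k1 t) (at t)" for t
    unfolding defs by (intro DERIV_Re_Im_along f b h)+
  have D2: 
    "(p1 has_real_derivative Re (d\<^sup>2 * f2 (?l t))) (at t)" "(q1 has_real_derivative Im (d\<^sup>2 * f2 (?l t))) (at t)" 
    "(x1 has_real_derivative Re (d\<^sup>2 * b2 (?l t))) (at t)" "(y1 has_real_derivative Im (d\<^sup>2 * b2 (?l t))) (at t)" 
    "(k1 has_real_derivative Re (d\<^sup>2 * h2 (?l t))) (at t)" for t
    unfolding defs power2_eq_square mult.assoc by (intro DERIV_Re_Im_along sc f b h)+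
  have D20: "(p1 has_real_derivative Re (d\<^sup>2 * f2 z)) (at 0)" "(q1 has_real_derivative Im (d\<^sup>2 * f2 z)) (at 0)" 
    "(x1 has_real_derivative Re (d\<^sup>2 * b2 z)) (at 0)" "(y1 has_real_derivative Im (d\<^sup>2 * b2 z)) (at 0)" 
    "(k1 has_real_derivative Re (d\<^sup>2 * h2 z)) (at 0)"
    using D2[of 0] by simp_all
  define V where "V t = sqrt ((p t)\<^sup>2 + (q t)\<^sup>2 + e)" for t
  define V1 where "V1 t = (p t * p1 t + q t * q1 t) / V t" for t
  define g where "g t = k t - ((x t)\<^sup>2 + (y t)\<^sup>2)" for t
  define g1 where "g1 t = k1 t - 2 * (x t * x1 t + y t * y1 t)" for t
  have Vpos: "V t > 0" for t using e unfolding V_def by (simp add: add_nonneg_pos)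
  have DV: "(V has_real_derivative V1 t) (at t)" for t
    unfolding V_def V1_def using Vpos[of t] e
    by (auto intro!: derivative_eq_intros D simp: V_def add_nonneg_pos field_simps)
  have DV1: "(V1 has_real_derivative ((p1 0)\<^sup>2 + (q1 0)\<^sup>2 + (p 0 * Re (d\<^sup>2 * f2 z) + q 0 * Im (d\<^sup>2 * f2 z))) / V 0
       - (p 0 * p1 0 + q 0 * q1 0)\<^sup>2 / V 0 ^ 3) (at 0)"
    unfolding V1_def[abs_def] using Vpos[of 0]
    by (auto intro!: derivative_eq_intros D D20 DV simp: V1_def field_simps power2_eq_square power3_eq_cube)
  have Dg: "(g has_real_derivative g1 t) (at t)" for t
    unfolding g_def g1_def by (auto intro!: derivative_eq_intros D)
  have Dg1: "(g1 has_real_derivative Re (d\<^sup>2 * h2 z) - 2 * ((x1 0)\<^sup>2 + (y1 0)\<^sup>2 + (x 0 * Re (d\<^sup>2 * b2 z) + y 0 * Im (d\<^sup>2 * b2 z)))) (at 0)"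
    unfolding g1_def[abs_def] by (auto intro!: derivative_eq_intros D D20 simp: power2_eq_square)
  define W1 where "W1 t = (5 + (2 - g t)\<^sup>2) * V1 t - 2 * (2 - g t) * g1 t * V t 
      - (p1 t * x t + p t * x1 t + q1 t * y t + q t * y1 t)" for t
  have eq: "(5 + (2 - G (?l t))\<^sup>2) * v (?l t) - Re (f (?l t) * cnj (b (?l t)))
      = (5 + (2 - g t)\<^sup>2) * V t - (p t * x t + q t * y t)" for t
    unfolding G_def v_def g_def V_def defs by (simp add: cmod_power2)
  have DW: "((\<lambda>t. (5 + (2 - G (?l t))\<^sup>2) * v (?l t) - Re (f (?l t) * cnj (b (?l t)))) has_real_derivative W1 t) (at t)" for t
    unfolding eq W1_def by (auto intro!: derivative_eq_intros D DV Dg)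
  have at0: "p 0 = Re (f z)" "q 0 = Im (f z)" "p1 0 = Re (d * f1 z)" "q1 0 = Im (d * f1 z)"
    "x 0 = Re (b z)" "y 0 = Im (b z)" "x1 0 = Re (d * b1 z)" "y1 0 = Im (d * b1 z)"
    "g 0 = G z" "V 0 = v z" "g1 0 = ga" "V1 0 = v1a"
    unfolding ga v1a G_def v_def g_def V_def g1_def V1_def defs by (simp_all add: cmod_power2)
  have DW1: "(W1 has_real_derivative 
     ((5 + (2 - g 0)\<^sup>2) * (((p1 0)\<^sup>2 + (q1 0)\<^sup>2 + (p 0 * Re (d\<^sup>2 * f2 z) + q 0 * Im (d\<^sup>2 * f2 z))) / V 0
       - (p 0 * p1 0 + q 0 * q1 0)\<^sup>2 / V 0 ^ 3)
     - 4 * (2 - g 0) * (g1 0 * V1 0) + 2 * (g1 0)\<^sup>2 * V 0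
     - 2 * (2 - g 0) * V 0 * (Re (d\<^sup>2 * h2 z) - 2 * ((x1 0)\<^sup>2 + (y1 0)\<^sup>2 + (x 0 * Re (d\<^sup>2 * b2 z) + y 0 * Im (d\<^sup>2 * b2 z))))
     - (2 * (p1 0 * x1 0 + q1 0 * y1 0) + (p 0 * Re (d\<^sup>2 * b2 z) + q 0 * Im (d\<^sup>2 * b2 z)) +
        (x 0 * Re (d\<^sup>2 * f2 z) + y 0 * Im (d\<^sup>2 * f2 z))))) (at 0)"
    unfolding W1_def[abs_def]
    apply (rule DERIV_cong)
     apply (rule derivative_intros D D20 DV DV1 Dg Dg1)+
    apply (simp add: algebra_simps power2_eq_square)
    done
  show ?thesis
    unfolding second_deriv_along_def using DW DW1 unfolding at0 by blast
qed

lemma subharmonic_test_function: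
  fixes f b h :: "complex \<Rightarrow> complex"
  assumes f: "f holomorphic_on UNIV" and b: "b holomorphic_on UNIV" and h: "h holomorphic_on UNIV"
    and G: "\<And>z. z \<in> ball 0 1 \<Longrightarrow> Re (h z) - (norm (b z))\<^sup>2 \<in> {0..1}" and e: "e > 0"
  shows "subharmonic_on (ball 0 1) (\<lambda>z. (5 + (2 - (Re (h z) - (norm (b z))\<^sup>2))\<^sup>2) * sqrt ((norm (f z))\<^sup>2 + e)
      - Re (f z * cnj (b z)))"
  unfolding subharmonic_on_def
proof (intro ballI allI impI)
  fix z d :: complex assume z: "z \<in> ball 0 1" "norm d = 1"
  have D: "(g has_field_derivative deriv g w) (at w)" "(deriv g has_field_derivative deriv (deriv g) w) (at w)"
    if "g holomorphic_on UNIV" for g w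
    using holomorphic_derivI[OF that] holomorphic_derivI[OF holomorphic_deriv[OF that]] by auto
  note S = second_deriv_along_test_function[OF D[OF f] D[OF b] D[OF h] e refl refl]
  define P Q X Y where PQXY: "P = Re (d * deriv f z)" "Q = Im (d * deriv f z)" 
    "X = Re (d * deriv b z)" "Y = Im (d * deriv b z)"
  define u where "u = 2 - (Re (h z) - (norm (b z))\<^sup>2)"
  define v where "v = sqrt ((norm (f z))\<^sup>2 + e)"
  have u: "1 \<le> u" "u \<le> 2" using G[OF z(1)] by (auto simp: u_def)
  have v: "v > 0" "v\<^sup>2 = (Re (f z))\<^sup>2 + (Im (f z))\<^sup>2 + e"
    using e by (auto simp: v_def add_nonneg_pos cmod_power2)
  define ga gb where "ga = Re (d * deriv h z) - 2 * (Re (b z) * X + Im (b z) * Y)"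
    "gb = Re (\<i> * d * deriv h z) - 2 * (Re (b z) * (- Y) + Im (b z) * X)"
  have i: "Re (\<i> * d * w) = - Im (d * w)" "Im (\<i> * d * w) = Re (d * w)" "(\<i> * d)\<^sup>2 * w = - (d\<^sup>2 * w)" for w
    by (simp_all add: power_mult_distrib)
  note S1 = S[of z d, folded u_def, folded v_def, folded PQXY, folded ga_gb_def]
  note S2 = S[of z "\<i> * d", folded u_def, folded v_def, unfolded i, folded PQXY]
  show "\<exists>p q. second_deriv_along (\<lambda>z. (5 + (2 - (Re (h z) - (norm (b z))\<^sup>2))\<^sup>2) * sqrt ((norm (f z))\<^sup>2 + e)
      - Re (f z * cnj (b z))) z d p \<and>
    second_deriv_along (\<lambda>z. (5 + (2 - (Re (h z) - (norm (b z))\<^sup>2))\<^sup>2) * sqrt ((norm (f z))\<^sup>2 + e)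
      - Re (f z * cnj (b z))) z (\<i> * d) q \<and> 0 \<le> p + q"
    apply (intro exI conjI)
      apply (rule S1)
     apply (rule S2)
    using test_function_laplacian_nonneg[OF v(1) v(2) e u, of P Q ga "- Im (d * deriv h z) - 2 * (Im (b z) * X - Re (b z) * Y)" X Y]
    apply (simp add: diff_divide_distrib add_divide_distrib algebra_simps)
    done
qed

section \<open>Finitely supported Hankel matrices tested on kernels\<close>

text \<open>
The \<open>\<beta> i\<close> are the iterated backward shifts of \<open>\<beta> 0\<close>. By the assumption, the function
\<open>G(z) = (1 - |z|\<^sup>2) * S z\<close> with \<open>S z = \<Sum>\<^sub>i |\<beta> (i + 1) z|\<^sup>2\<close> has values in \<open>[0, 1]\<close> in the disc and
vanishes on the circle. The recursion \<open>\<beta> i z = cnj (b i) + z * \<beta> (i + 1) z\<close> makes the sum telescope, which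
identifies \<open>G\<close> with \<open>Re h - |\<beta> 0|\<^sup>2\<close> for a polynomial \<open>h\<close>. So the test function is available.
\<close>
lemma hankel_pairing_Re_le:
  fixes b q :: "nat \<Rightarrow> complex"
  assumes b0: "\<And>m. m \<ge> n \<Longrightarrow> b m = 0"
    and test: "\<And>l. norm l < 1 \<Longrightarrow> (1 - (norm l)\<^sup>2) * (\<Sum>i<n. (norm (\<Sum>j<n. b (i + j) * l ^ j))\<^sup>2) \<le> 1"
  shows "Re (\<Sum>m\<le>d. b m * q m) \<le> 9 * (\<integral>z. norm (\<Sum>m\<le>d. q m * z ^ m) \<partial>circle_measure)"
proof -
  define f where "f z = (\<Sum>m\<le>d. q m * z ^ m)" for z
  define \<beta> where "\<beta> i z = (\<Sum>j<n. cnj (b (i + j)) * z ^ j)" for i z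
  define h where "h z = (\<Sum>i<n. 2 * b i * \<beta> i z - of_real ((norm (b i))\<^sup>2))" for z
  have holo: "f holomorphic_on UNIV" "\<beta> i holomorphic_on UNIV" "h holomorphic_on UNIV" for i
    unfolding f_def[abs_def] \<beta>_def[abs_def] h_def[abs_def] by (intro holomorphic_intros)+
  have shift: "\<beta> i z = cnj (b i) + z * \<beta> (Suc i) z" for i z
  proof -
    have "\<beta> i z = (\<Sum>j<Suc n. cnj (b (i + j)) * z ^ j)" unfolding \<beta>_def using b0[of "i + n"] by simp
    also have "\<dots> = cnj (b i) + z * \<beta> (Suc i) z"
      unfolding \<beta>_def by (subst sum.lessThan_Suc_shift) (simp add: sum_distrib_left mult_ac)
    finally show ?thesis .
  qed
  define S where "S z = (\<Sum>i<n. (norm (\<beta> (Suc i) z))\<^sup>2)" for z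
  have S_eq: "S z = (\<Sum>i<n. (norm (\<beta> i z))\<^sup>2) - (norm (\<beta> 0 z))\<^sup>2" for z
  proof -
    have "S z + (norm (\<beta> 0 z))\<^sup>2 = (\<Sum>i<Suc n. (norm (\<beta> i z))\<^sup>2)"
      unfolding S_def by (subst sum.lessThan_Suc_shift) simp
    moreover have "\<beta> n z = 0" unfolding \<beta>_def using b0 by simp
    ultimately show ?thesis by simp
  qed
  have G_eq: "Re (h z) - (norm (\<beta> 0 z))\<^sup>2 = (1 - (norm z)\<^sup>2) * S z" for z
  proof -
    have "(norm z)\<^sup>2 * S z = (\<Sum>i<n. (norm (\<beta> i z - cnj (b i)))\<^sup>2)"
      unfolding S_def sum_distrib_left
      by (intro sum.cong refl) (subst shift, simp add: norm_mult power_mult_distrib)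
    also have "\<dots> = (\<Sum>i<n. (norm (\<beta> i z))\<^sup>2 - Re (2 * b i * \<beta> i z - of_real ((norm (b i))\<^sup>2)))"
    proof (intro sum.cong refl)
      fix i
      show "(norm (\<beta> i z - cnj (b i)))\<^sup>2 = (norm (\<beta> i z))\<^sup>2 - Re (2 * b i * \<beta> i z - of_real ((norm (b i))\<^sup>2))"
        unfolding cmod_power2 by (simp add: power2_eq_square algebra_simps)
    qed
    also have "\<dots> = (\<Sum>i<n. (norm (\<beta> i z))\<^sup>2) - Re (h z)"
      unfolding h_def by (simp add: sum_subtractf)
    finally have "(norm z)\<^sup>2 * S z = (\<Sum>i<n. (norm (\<beta> i z))\<^sup>2) - Re (h z)" .
    then show ?thesis unfolding left_diff_distrib using S_eq[of z] by linarith
  qed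
  have G01: "Re (h z) - (norm (\<beta> 0 z))\<^sup>2 \<in> {0..1}" if z: "z \<in> ball 0 1" for z
  proof -
    have pos: "1 - (norm z)\<^sup>2 \<ge> 0" using z by (simp add: power_le_one)
    have cn: "(\<Sum>j<n. b (i + j) * cnj z ^ j) = cnj (\<beta> i z)" for i unfolding \<beta>_def by simp
    have "(1 - (norm z)\<^sup>2) * S z \<le> (1 - (norm z)\<^sup>2) * (\<Sum>i<n. (norm (\<beta> i z))\<^sup>2)"
      unfolding S_eq using pos by (intro mult_left_mono) auto
    also have "\<dots> \<le> 1" using test[of "cnj z"] z unfolding cn by simp
    finally show ?thesis unfolding G_eq using pos by (auto simp: S_def intro!: mult_nonneg_nonneg sum_nonneg)
  qed
  have GT: "Re (h z) - (norm (\<beta> 0 z))\<^sup>2 = 0" if "z \<in> torus" for z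
    using that unfolding G_eq by simp
  have cont: "continuous_on A f" "continuous_on A (\<beta> i)" "continuous_on A h" for A i
    using holo holomorphic_on_imp_continuous_on continuous_on_subset by blast+
  have b0_le: "norm (b 0) \<le> 1"
  proof (cases "n = 0")
    case False
    have "(\<Sum>j<n. b (i + j) * 0 ^ j) = b i" for i
      using False by (simp add: power_0_left if_distrib[of "\<lambda>x. _ * x"] sum.delta cong: if_cong)
    then have "(norm (b 0))\<^sup>2 \<le> (\<Sum>i<n. (norm (\<Sum>j<n. b (i + j) * 0 ^ j))\<^sup>2)"
      using False member_le_sum[of 0 "{..<n}" "\<lambda>i. (norm (b i))\<^sup>2"] by simp
    also have "\<dots> \<le> 1" using test[of 0] by simp
    finally show ?thesis by (simp add: power2_le_iff_abs_le abs_square_le_1)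
  qed (simp add: b0)
  have le_eps: "Re (\<Sum>m\<le>d. b m * q m) \<le> 9 * (\<integral>z. norm (f z) \<partial>circle_measure) + 9 * e" if e: "e > 0" for e
  proof -
    define W where "W z = (5 + (2 - (Re (h z) - (norm (\<beta> 0 z))\<^sup>2))\<^sup>2) * sqrt ((norm (f z))\<^sup>2 + e\<^sup>2)
      - Re (f z * cnj (\<beta> 0 z))" for z
    \<comment> \<open>the test at \<open>l = 0\<close> bounds \<open>b 0\<close>, and therefore no boundary term is left over at the centre\<close>
    have "0 \<le> W 0"
    proof -
      have f0: "f 0 = q 0" unfolding f_def by (simp add: power_0_left if_distrib[of "\<lambda>x. _ * x"] sum.delta cong: if_cong)
      have \<beta>0: "\<beta> 0 0 = cnj (b 0)" using shift[of 0 0] by simp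
      have "Re (f 0 * cnj (\<beta> 0 0)) \<le> norm (q 0) * norm (b 0)"
        unfolding f0 \<beta>0 using complex_Re_le_cmod[of "q 0 * b 0"] by (simp add: norm_mult)
      also have "\<dots> \<le> norm (q 0)" using b0_le by (simp add: mult_left_le)
      also have "\<dots> \<le> sqrt ((norm (f 0))\<^sup>2 + e\<^sup>2)" unfolding f0 by (rule real_le_rsqrt) simp
      also have "\<dots> \<le> (5 + (2 - (Re (h 0) - (norm (\<beta> 0 0))\<^sup>2))\<^sup>2) * sqrt ((norm (f 0))\<^sup>2 + e\<^sup>2)"
      proof -
        have "1 \<le> 5 + (2 - (Re (h 0) - (norm (\<beta> 0 0))\<^sup>2))\<^sup>2"
          using zero_le_power2[of "2 - (Re (h 0) - (norm (\<beta> 0 0))\<^sup>2)"] by linarith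
        from mult_right_mono[OF this, of "sqrt ((norm (f 0))\<^sup>2 + e\<^sup>2)"] show ?thesis by simp
      qed
      finally show ?thesis unfolding W_def by simp
    qed
    also have "W 0 \<le> (\<integral>z. W z \<partial>circle_measure)"
    proof (rule subharmonic_le_circle_integral)
      show "subharmonic_on (ball 0 1) W"
        unfolding W_def[abs_def] using e by (intro subharmonic_test_function holo G01) auto
      show "continuous_on (cball 0 1) W" unfolding W_def[abs_def] by (intro continuous_intros cont)
    qed
    also have "(\<integral>z. W z \<partial>circle_measure) \<le> (\<integral>z. 9 * (norm (f z) + e) - Re (f z * cnj (\<beta> 0 z)) \<partial>circle_measure)"
    proof (rule integral_mono)
      show "integrable circle_measure W" unfolding W_def[abs_def]
        by (intro continuous_imp_circle_integrable continuous_intros cont)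
      show "integrable circle_measure (\<lambda>z. 9 * (norm (f z) + e) - Re (f z * cnj (\<beta> 0 z)))"
        by (intro continuous_imp_circle_integrable continuous_intros cont)
      fix z assume z: "z \<in> space circle_measure"
      have "sqrt ((norm (f z))\<^sup>2 + e\<^sup>2) \<le> norm (f z) + e"
        using e sqrt_add_le_add_sqrt[of "(norm (f z))\<^sup>2" "e\<^sup>2"] by simp
      moreover have "W z = 9 * sqrt ((norm (f z))\<^sup>2 + e\<^sup>2) - Re (f z * cnj (\<beta> 0 z))"
        unfolding W_def using GT[of z] z by simp
      ultimately show "W z \<le> 9 * (norm (f z) + e) - Re (f z * cnj (\<beta> 0 z))" by simp
    qed
    also have "\<dots> = 9 * ((\<integral>z. norm (f z) \<partial>circle_measure) + e) - Re (\<integral>z. f z * cnj (\<beta> 0 z) \<partial>circle_measure)"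
    proof -
      have i: "integrable circle_measure (\<lambda>z. norm (f z))" "integrable circle_measure (\<lambda>z. f z * cnj (\<beta> 0 z))"
        by (intro continuous_imp_circle_integrable continuous_intros cont)+
      have "(\<integral>z. 9 * (norm (f z) + e) - Re (k z) \<partial>circle_measure)
          = 9 * ((\<integral>z. norm (f z) \<partial>circle_measure) + e) - Re (\<integral>z. k z \<partial>circle_measure)"
        if "integrable circle_measure k" for k
        using that i(1) circle.prob_space by simp
      from this[OF i(2)] show ?thesis .
    qed
    also have "(\<integral>z. f z * cnj (\<beta> 0 z) \<partial>circle_measure) = (\<Sum>m\<in>{..d} \<inter> {..<n}. q m * b m)"
      unfolding f_def \<beta>_def by (subst circle_inner_polynomials) auto
    also have "\<dots> = (\<Sum>m\<le>d. q m * b m)"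
      by (rule sum.mono_neutral_left) (auto intro: b0)
    finally show ?thesis by (simp add: mult.commute)
  qed
  show ?thesis
  proof (rule field_le_epsilon)
    fix e :: real assume "e > 0"
    then show "Re (\<Sum>m\<le>d. b m * q m) \<le> 9 * (\<integral>z. norm (\<Sum>m\<le>d. q m * z ^ m) \<partial>circle_measure) + e"
      using le_eps[of "e / 9"] unfolding f_def by simp
  qed
qed

lemma cnj_sgn_mult: "cnj (sgn w) * w = of_real (norm w)"
proof -
  have "cnj (sgn w) * w = (w * cnj w) / of_real (norm w)" by (simp add: sgn_eq)
  also have "\<dots> = of_real (norm w)"
    unfolding complex_norm_square[symmetric] by (simp add: power2_eq_square)
  finally show ?thesis .
qed

text \<open>
Homogeneity reduces the claim to the normalized case: division by some \<open>s > r\<close> avoids the case \<open>r = 0\<close>,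
and a unimodular factor replaces the real part by the modulus.
\<close>
lemma hankel_pairing_le:
  fixes b q :: "nat \<Rightarrow> complex"
  assumes b0: "\<And>m. m \<ge> n \<Longrightarrow> b m = 0" and r: "r \<ge> 0"
    and test: "\<And>l. norm l < 1 \<Longrightarrow> (1 - (norm l)\<^sup>2) * (\<Sum>i<n. (norm (\<Sum>j<n. b (i + j) * l ^ j))\<^sup>2) \<le> r\<^sup>2"
  shows "norm (\<Sum>m\<le>d. b m * q m) \<le> 9 * r * (\<integral>z. norm (\<Sum>m\<le>d. q m * z ^ m) \<partial>circle_measure)"
proof -
  define I where "I = (\<integral>z. norm (\<Sum>m\<le>d. q m * z ^ m) \<partial>circle_measure)"
  have I: "I \<ge> 0" unfolding I_def by simp
  have *: "norm (\<Sum>m\<le>d. b m * q m) \<le> 9 * s * I" if s: "s > r" for s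
  proof -
    define c where "c = cnj (sgn (\<Sum>m\<le>d. b m * q m))"
    have s0: "s > 0" using r s by simp
    have c: "c * (\<Sum>m\<le>d. b m * q m) = norm (\<Sum>m\<le>d. b m * q m)"
      unfolding c_def by (rule cnj_sgn_mult)
    have "Re (\<Sum>m\<le>d. (c * b m / s) * q m) \<le> 9 * (\<integral>z. norm (\<Sum>m\<le>d. q m * z ^ m) \<partial>circle_measure)"
    proof (rule hankel_pairing_Re_le)
      show "c * b m / s = 0" if "m \<ge> n" for m using b0[OF that] by simp
      fix l :: complex assume l: "norm l < 1"
      have "norm c \<le> 1" unfolding c_def by (simp add: norm_sgn)
      then have c1: "(norm c)\<^sup>2 \<le> 1" by (simp add: power_le_one)
      define A where "A i = (\<Sum>j<n. b (i + j) * l ^ j)" for i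
      have "(\<Sum>j<n. (c * b (i + j) / s) * l ^ j) = (c / s) * A i" for i
        unfolding A_def sum_distrib_left by (intro sum.cong) auto
      note pull = this
      have "(1 - (norm l)\<^sup>2) * (\<Sum>i<n. (norm (\<Sum>j<n. (c * b (i + j) / s) * l ^ j))\<^sup>2)
         = ((norm c)\<^sup>2 / s\<^sup>2) * ((1 - (norm l)\<^sup>2) * (\<Sum>i<n. (norm (\<Sum>j<n. b (i + j) * l ^ j))\<^sup>2))"
        unfolding pull A_def[symmetric] using s0
        by (simp add: norm_mult norm_divide power_mult_distrib power_divide sum_distrib_left mult_ac)
      also have "\<dots> \<le> ((norm c)\<^sup>2 / s\<^sup>2) * r\<^sup>2"
        using test[OF l] by (intro mult_left_mono) auto
      also have "\<dots> \<le> 1"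
        using mult_mono[of "(norm c)\<^sup>2" 1 "r\<^sup>2" "s\<^sup>2"] c1 r s s0 by (simp add: power_mono)
      finally show "(1 - (norm l)\<^sup>2) * (\<Sum>i<n. (norm (\<Sum>j<n. (c * b (i + j) / s) * l ^ j))\<^sup>2) \<le> 1" .
    qed
    also have "(\<Sum>m\<le>d. (c * b m / s) * q m) = of_real (norm (\<Sum>m\<le>d. b m * q m) / s)"
      using c unfolding sum_distrib_left of_real_divide c[symmetric] by (simp add: sum_divide_distrib mult_ac)
    finally show ?thesis using s0 by (simp add: field_simps I_def)
  qed
  have "((\<lambda>s. 9 * s * I) \<longlongrightarrow> 9 * r * I) (at_right r)" by (intro tendsto_intros)
  moreover have "eventually (\<lambda>s. norm (\<Sum>m\<le>d. b m * q m) \<le> 9 * s * I) (at_right r)"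
    using * by (auto simp: eventually_at_filter)
  ultimately show ?thesis unfolding I_def[symmetric] by (intro tendsto_lowerbound) auto
qed

section \<open>Bounded functions with prescribed Fourier coefficients\<close>

text \<open>
By assumption the functional \<open>J q = K * \<integral> sqrt (|f q|\<^sup>2 + 1) - Re (\<Sum> c m * q m)\<close> is nonnegative. If it had a
minimum, vanishing of its derivative there would say that \<open>\<psi> = K * cnj (f q) / sqrt (|f q|\<^sup>2 + 1)\<close>, which is
bounded by \<open>K\<close>, has exactly the coefficients \<open>c m\<close>. An approximate minimum gives them up to errors \<open>e m\<close> as
small as desired, and a trigonometric polynomial bounded by \<open>K\<close> removes these.
\<close>
lemma symbol_of_bounded_pairing:
  fixes c :: "nat \<Rightarrow> complex"
  assumes K: "K \<ge> 0"
    and le: "\<And>q. norm (\<Sum>m\<le>d. c m * q m) \<le> K * (\<integral>z. norm (\<Sum>m\<le>d. q m * z ^ m) \<partial>circle_measure)"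
  obtains \<psi> where "continuous_on torus \<psi>" "\<And>z. z \<in> torus \<Longrightarrow> norm (\<psi> z) \<le> 2 * K"
    "\<And>m. m \<le> d \<Longrightarrow> (\<integral>z. \<psi> z * z ^ m \<partial>circle_measure) = c m"
proof (cases "K = 0")
  case True
  have "c m = 0" if "m \<le> d" for m
    using le[of "\<lambda>j. if j = m then 1 else 0"] True that
    by (simp add: if_distrib[of "\<lambda>x. _ * x"] sum.delta cong: if_cong)
  then show ?thesis using that[of "\<lambda>_. 0"] True by auto
next
  case False
  then have K: "K > 0" using K by simp
  define f where "f q z = (\<Sum>m\<le>d. q m * z ^ m)" for q :: "nat \<Rightarrow> complex" and z
  have cf: "continuous_on A (f q)" for A q unfolding f_def[abs_def] by (intro continuous_intros)
  define v where "v q z = sqrt ((norm (f q z))\<^sup>2 + 1)" for q z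
  have v_pos: "v q z \<ge> 1" for q z unfolding v_def by simp
  have v0: "v q z \<noteq> 0" for q z using v_pos[of q z] by linarith
  have cv: "continuous_on A (v q)" for A q unfolding v_def[abs_def] by (intro continuous_intros cf)
  define J where "J q = K * (\<integral>z. v q z \<partial>circle_measure) - Re (\<Sum>m\<le>d. c m * q m)" for q
  have J: "J q \<ge> 0" for q
  proof -
    have "Re (\<Sum>m\<le>d. c m * q m) \<le> K * (\<integral>z. norm (f q z) \<partial>circle_measure)"
      using complex_Re_le_cmod le order_trans unfolding f_def by blast
    also have "\<dots> \<le> K * (\<integral>z. v q z \<partial>circle_measure)"
    proof (intro mult_left_mono integral_mono)
      show "norm (f q z) \<le> v q z" for z unfolding v_def by (rule real_le_rsqrt) simp
    qed (use K in \<open>auto intro!: continuous_imp_circle_integrable continuous_intros cf cv\<close>)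
    finally show ?thesis unfolding J_def by simp
  qed
  \<comment> \<open>chosen such that the \<open>d + 1\<close> errors resulting from \<open>|e m|\<^sup>2 \<le> 2 * K * \<eta>\<close> add up to at most \<open>K\<close>\<close>
  define \<eta> where "\<eta> = K / (2 * (real d + 1)\<^sup>2)"
  have \<eta>: "\<eta> > 0" using K by (simp add: \<eta>_def)
  have bdd: "bdd_below (range J)" using J by (auto intro!: bdd_belowI[of _ 0])
  obtain q where q: "J q \<le> J q' + \<eta>" for q'
  proof -
    have "Inf (range J) < Inf (range J) + \<eta>" using \<eta> by simp
    from cInf_lessD[OF _ this] obtain q where "J q < Inf (range J) + \<eta>" by blast
    then show ?thesis using that[of q] cInf_lower[OF _ bdd] by (smt (verit) rangeI)
  qed
  define \<psi> where "\<psi> z = K * cnj (f q z) / v q z" for z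
  have c\<psi>: "continuous_on A \<psi>" for A 
    unfolding \<psi>_def[abs_def] by (intro continuous_intros cf cv) (simp add: v0)
  have \<psi>_le: "norm (\<psi> z) \<le> K" for z
  proof -
    have "norm (f q z) \<le> v q z" unfolding v_def by (rule real_le_rsqrt) simp
    then show ?thesis unfolding \<psi>_def using K v_pos[of q z] by (simp add: norm_mult norm_divide divide_le_eq)
  qed
  define e where "e m = (\<integral>z. \<psi> z * z ^ m \<partial>circle_measure) - c m" for m
  have e_le: "(real d + 1) * norm (e m) \<le> K" if m: "m \<le> d" for m
  proof -
    \<comment> \<open>the step of steepest descent in the \<open>m\<close>-th coefficient, of optimal length for the quadratic bound below\<close>
    define s where "s = - cnj (e m) / K"
    define q' where "q' = q(m := q m + s)"
    have fq': "f q' z = f q z + s * z ^ m" for z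
    proof -
      have "f q' z = (\<Sum>i\<le>d. q i * z ^ i + (if i = m then s * z ^ m else 0))"
        unfolding f_def q'_def by (intro sum.cong) (auto simp: algebra_simps)
      then show ?thesis using m by (simp add: sum.distrib f_def)
    qed
    have Lq': "(\<Sum>i\<le>d. c i * q' i) = (\<Sum>i\<le>d. c i * q i) + c m * s"
    proof -
      have "(\<Sum>i\<le>d. c i * q' i) = (\<Sum>i\<le>d. c i * q i + (if i = m then c m * s else 0))"
        unfolding q'_def by (intro sum.cong) (auto simp: algebra_simps)
      then show ?thesis using m by (simp add: sum.distrib)
    qed
    \<comment> \<open>tangent line bound for the square root; since \<open>v q \<ge> 1\<close>, the quadratic term has coefficient at most \<open>1 / 2\<close>\<close>
    have pt: "K * v q' z \<le> K * v q z + Re (s * (\<psi> z * z ^ m)) + K * (norm s)\<^sup>2 / 2" if z: "z \<in> torus" for z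
    proof -
      define w where "w = s * z ^ m"
      have nw: "(norm w)\<^sup>2 = (norm s)\<^sup>2" using z by (simp add: w_def norm_mult norm_power)
      have sq: "(v q' z)\<^sup>2 = (v q z)\<^sup>2 + 2 * Re (cnj (f q z) * w) + (norm s)\<^sup>2"
      proof -
        have vsq: "(v a z)\<^sup>2 = (norm (f a z))\<^sup>2 + 1" for a unfolding v_def by simp
        have "(norm (f q z + w))\<^sup>2 = (norm (f q z))\<^sup>2 + 2 * Re (cnj (f q z) * w) + (norm w)\<^sup>2"
          unfolding cmod_power2 by (simp add: power2_eq_square algebra_simps)
        then show ?thesis unfolding vsq fq' w_def[symmetric] nw[symmetric] by simp
      qed
      have "2 * v q z * v q' z \<le> (v q z)\<^sup>2 + (v q' z)\<^sup>2"
        using sum_squares_bound[of "v q z" "v q' z"] by simp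
      then have "2 * v q z * v q' z \<le> 2 * (v q z)\<^sup>2 + 2 * Re (cnj (f q z) * w) + (norm s)\<^sup>2"
        unfolding sq by simp
      then have "v q' z \<le> (2 * (v q z)\<^sup>2 + 2 * Re (cnj (f q z) * w) + (norm s)\<^sup>2) / (2 * v q z)"
        using v_pos[of q z] by (simp add: le_divide_eq mult_ac)
      also have "\<dots> = v q z + Re (cnj (f q z) * w) / v q z + (norm s)\<^sup>2 / (2 * v q z)"
        using v0[of q z] by (simp add: add_divide_distrib power2_eq_square)
      also have "(norm s)\<^sup>2 / (2 * v q z) \<le> (norm s)\<^sup>2 / 2"
        using v_pos[of q z] by (intro divide_left_mono) auto
      finally have "K * v q' z \<le> K * (v q z + Re (cnj (f q z) * w) / v q z + (norm s)\<^sup>2 / 2)"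
        using K by (intro mult_left_mono) auto
      moreover have "Re (s * (\<psi> z * z ^ m)) = K * (Re (cnj (f q z) * w) / v q z)"
      proof -
        have "s * (\<psi> z * z ^ m) = of_real (K / v q z) * (cnj (f q z) * w)"
          unfolding \<psi>_def w_def by simp
        moreover have "Re (of_real a * b) = a * Re b" for a b by simp
        ultimately show ?thesis by (simp only:) simp
      qed
      ultimately show ?thesis by (simp add: algebra_simps)
    qed
    have ci: "integrable circle_measure (\<lambda>z. s * (\<psi> z * z ^ m))"
      by (intro continuous_imp_circle_integrable continuous_intros c\<psi>)
    have cvi: "integrable circle_measure (v q)" for q by (intro continuous_imp_circle_integrable cv)
    have "K * (\<integral>z. v q' z \<partial>circle_measure) = (\<integral>z. K * v q' z \<partial>circle_measure)" by simp
    also have "\<dots> \<le> (\<integral>z. K * v q z + Re (s * (\<psi> z * z ^ m)) + K * (norm s)\<^sup>2 / 2 \<partial>circle_measure)"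
      by (rule integral_mono) (use pt ci cvi in \<open>auto simp del: times_complex.sel\<close>)
    also have "\<dots> = K * (\<integral>z. v q z \<partial>circle_measure) + Re (s * (\<integral>z. \<psi> z * z ^ m \<partial>circle_measure)) + K * (norm s)\<^sup>2 / 2"
    proof -
      have "(\<integral>z. Re (s * (\<psi> z * z ^ m)) \<partial>circle_measure) = Re (s * (\<integral>z. \<psi> z * z ^ m \<partial>circle_measure))"
        using ci by (simp del: times_complex.sel)
      then show ?thesis using ci cvi[of q] circle.prob_space by (simp del: times_complex.sel)
    qed
    finally have "J q' \<le> J q + Re (s * e m) + K * (norm s)\<^sup>2 / 2"
      unfolding J_def Lq' e_def by (simp add: algebra_simps)
    moreover have "Re (s * e m) = - (norm (e m))\<^sup>2 / K"
    proof -
      have "s * e m = of_real (- (norm (e m))\<^sup>2 / K)"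
        unfolding s_def using complex_norm_square[of "e m"] by (simp add: mult.commute)
      then show ?thesis by (simp only: Re_complex_of_real)
    qed
    moreover have "K * (norm s)\<^sup>2 / 2 = (norm (e m))\<^sup>2 / K / 2"
      unfolding s_def using K by (simp add: norm_divide power_divide power2_eq_square)
    ultimately have "(norm (e m))\<^sup>2 / K / 2 \<le> \<eta>" using q[of q'] by simp
    moreover have "x * D \<le> K\<^sup>2" if "x / K / 2 \<le> K / (2 * D)" "D > 0" for x D :: real
      using that K by (simp add: field_simps power2_eq_square)
    ultimately have "(norm (e m))\<^sup>2 * (real d + 1)\<^sup>2 \<le> K\<^sup>2"
      unfolding \<eta>_def by simp
    then have "((real d + 1) * norm (e m))\<^sup>2 \<le> K\<^sup>2" by (simp add: power_mult_distrib mult.commute)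
    then show ?thesis using K by (simp add: power2_le_iff_abs_le)
  qed
  define \<phi> where "\<phi> z = \<psi> z - cnj (\<Sum>j\<le>d. cnj (e j) * z ^ j)" for z
  show ?thesis
  proof (rule that[of \<phi>])
    show "continuous_on torus \<phi>" unfolding \<phi>_def[abs_def] by (intro continuous_intros c\<psi>)
    fix z assume z: "z \<in> torus"
    have "norm (\<Sum>j\<le>d. cnj (e j) * z ^ j) \<le> (\<Sum>j\<le>d. K / (real d + 1))"
      using z e_le K by (intro sum_norm_le) (simp add: norm_mult norm_power field_simps)
    also have "\<dots> = K" by (simp add: field_simps add_eq_0_iff)
    finally show "norm (\<phi> z) \<le> 2 * K"
      unfolding \<phi>_def using norm_triangle_ineq4[of "\<psi> z" "cnj (\<Sum>j\<le>d. cnj (e j) * z ^ j)"] \<psi>_le[of z]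
      by (simp only: complex_mod_cnj)
  next
    fix m assume m: "m \<le> d"
    have "(\<integral>z. \<phi> z * z ^ m \<partial>circle_measure) = (\<integral>z. \<psi> z * z ^ m - (\<Sum>i\<in>{m}. 1 * z ^ i) * cnj (\<Sum>j\<le>d. cnj (e j) * z ^ j) \<partial>circle_measure)"
      unfolding \<phi>_def by (simp only: left_diff_distrib) (simp add: mult.commute)
    also have "\<dots> = (\<integral>z. \<psi> z * z ^ m \<partial>circle_measure) - (\<integral>z. (\<Sum>i\<in>{m}. 1 * z ^ i) * cnj (\<Sum>j\<le>d. cnj (e j) * z ^ j) \<partial>circle_measure)"
      by (intro Bochner_Integration.integral_diff continuous_imp_circle_integrable continuous_intros c\<psi>)
    also have "\<dots> = c m"
      using m by (subst circle_inner_polynomials) (auto simp: e_def)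
    finally show "(\<integral>z. \<phi> z * z ^ m \<partial>circle_measure) = c m" .
  qed
qed

section \<open>Toeplitz matrices tested on kernels\<close>

lemma norm_sum_mult_le_sqrt:
  fixes a b :: "'i \<Rightarrow> complex"
  shows "norm (\<Sum>i\<in>A. a i * b i) \<le> sqrt (\<Sum>i\<in>A. (norm (a i))\<^sup>2) * sqrt (\<Sum>i\<in>A. (norm (b i))\<^sup>2)"
proof -
  have "norm (\<Sum>i\<in>A. a i * b i) \<le> (\<Sum>i\<in>A. \<bar>norm (a i)\<bar> * \<bar>norm (b i)\<bar>)"
    by (intro order_trans[OF norm_sum]) (simp add: norm_mult)
  also have "\<dots> \<le> L2_set (\<lambda>i. norm (a i)) A * L2_set (\<lambda>i. norm (b i)) A"
    by (rule L2_set_mult_ineq)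
  finally show ?thesis unfolding L2_set_def .
qed

text \<open>
The vectors \<open>(l ^ j)\<close>, \<open>j < N\<close>, have squared norm \<open>\<Sum> |l| ^ (2 * j)\<close>. So the Hankel matrix \<open>c (i + j)\<close>
of size \<open>N\<close> sends the normalized geometric vectors to vectors of norm at most \<open>r\<close>.
\<close>
definition kernel_test :: "nat \<Rightarrow> (nat \<Rightarrow> complex) \<Rightarrow> real \<Rightarrow> bool" where
  "kernel_test N c r \<longleftrightarrow> (\<forall>l. norm l < 1 \<longrightarrow>
     (\<Sum>i<N. (norm (\<Sum>j<N. c (i + j) * l ^ j))\<^sup>2) \<le> r\<^sup>2 * (\<Sum>j<N. (norm l) ^ (2 * j)))"

text \<open>
Only pairs of exponents \<open>s, t < N\<close> with \<open>s = t + m + 1\<close> contribute.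
\<close>
lemma fejer_weight_coefficient:
  "(\<integral>z. of_real ((norm (\<Sum>s<N. z ^ s))\<^sup>2) * cnj z ^ Suc m \<partial>circle_measure) = of_nat (N - Suc m)"
proof -
  have "(\<Sum>s<N. z ^ s) * cnj (\<Sum>t\<in>{Suc m..<N + Suc m}. 1 * z ^ t)
      = of_real ((norm (\<Sum>s<N. z ^ s))\<^sup>2) * cnj z ^ Suc m" for z
  proof -
    have "(\<Sum>t\<in>{Suc m..<N + Suc m}. z ^ t) = (\<Sum>t<N. z ^ t) * z ^ Suc m"
      using sum.shift_bounds_nat_ivl[of "\<lambda>t. z ^ t" 0 "Suc m" N]
      by (simp only: add_0 lessThan_atLeast0 power_add sum_distrib_right)
    then show ?thesis by (simp only: complex_norm_square mult_1 complex_cnj_mult complex_cnj_power mult.assoc)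
  qed
  then have "(\<integral>z. of_real ((norm (\<Sum>s<N. z ^ s))\<^sup>2) * cnj z ^ Suc m \<partial>circle_measure)
      = (\<integral>z. (\<Sum>s<N. 1 * z ^ s) * cnj (\<Sum>t\<in>{Suc m..<N + Suc m}. 1 * z ^ t) \<partial>circle_measure)"
    by (simp only: mult_1)
  also have "\<dots> = (\<Sum>i\<in>{..<N} \<inter> {Suc m..<N + Suc m}. 1 * cnj 1)"
    by (rule circle_inner_polynomials) auto
  also have "{..<N} \<inter> {Suc m..<N + Suc m} = {Suc m..<N}" by auto
  finally show ?thesis by simp
qed

lemma fejer_weight_integral:
  "(\<integral>z. (norm (\<Sum>s<N. z ^ s))\<^sup>2 \<partial>circle_measure) = real N"
proof -
  have "complex_of_real (\<integral>z. (norm (\<Sum>s<N. z ^ s))\<^sup>2 \<partial>circle_measure)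
      = (\<integral>z. (\<Sum>s<N. 1 * z ^ s) * cnj (\<Sum>s<N. 1 * z ^ s) \<partial>circle_measure)"
    unfolding complex_norm_square[symmetric] mult_1 by (rule integral_complex_of_real[symmetric])
  also have "\<dots> = of_real (real N)" by (subst circle_inner_polynomials) auto
  finally show ?thesis by (simp only: of_real_eq_iff)
qed

text \<open>
The factor \<open>(N - 1 - m)\<^sup>+ / N\<close> is the average of \<open>cnj z ^ (m + 1)\<close> with respect to a probability density
\<open>w\<close> on the circle. Hence the weighted matrix is an average of the matrices \<open>c (i + j) * cnj z ^ (i + j + 1)\<close>,
and these satisfy the same bound because they act on \<open>(l ^ j)\<close> as \<open>c (i + j)\<close> acts on the rotated vector
\<open>((l * cnj z) ^ j)\<close>, up to unimodular factors in the rows. The norm of the average of the image vectors is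
estimated by pairing that average, \<open>X\<close>, with itself.
\<close>
lemma kernel_test_edge:
  assumes N: "N \<ge> 1" and r: "r \<ge> 0" and test: "kernel_test N c r"
  shows "kernel_test N (\<lambda>m. of_real (real (N - Suc m) / N) * c m) r"
  unfolding kernel_test_def
proof (intro allI impI)
  fix l :: complex assume l: "norm l < 1"
  define w where "w z = (norm (\<Sum>s<N. z ^ s))\<^sup>2 / N" for z :: complex
  define Y where "Y i z = (\<Sum>j<N. c (i + j) * (l * cnj z) ^ j)" for i z
  define X where "X i = (\<Sum>j<N. of_real (real (N - Suc (i + j)) / N) * c (i + j) * l ^ j)" for i
  define T where "T = (\<Sum>i<N. (norm (X i))\<^sup>2)"
  define s where "s = (\<Sum>j<N. (norm l) ^ (2 * j))"
  have w: "continuous_on A w" "w z \<ge> 0" "(\<integral>z. w z \<partial>circle_measure) = 1" for A z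
    using N fejer_weight_integral[of N] unfolding w_def[abs_def] by (auto intro!: continuous_intros)
  have cY: "continuous_on A (Y i)" for A i unfolding Y_def[abs_def] by (intro continuous_intros)
  have T0: "T \<ge> 0" "s \<ge> 0" unfolding T_def s_def by (auto intro!: sum_nonneg)
  have Yle: "(\<Sum>i<N. (norm (Y i z))\<^sup>2) \<le> r\<^sup>2 * s" if "z \<in> torus" for z
    using test[unfolded kernel_test_def, rule_format, of "l * cnj z"] that l
    unfolding Y_def s_def by (simp add: norm_mult)
  have coef: "of_real (real (N - Suc m) / N) = (\<integral>z. of_real (w z) * cnj z ^ Suc m \<partial>circle_measure)" for m
  proof -
    have "(\<integral>z. of_real (w z) * cnj z ^ Suc m \<partial>circle_measure)
        = (\<integral>z. (of_real ((norm (\<Sum>s<N. z ^ s))\<^sup>2) * cnj z ^ Suc m) / of_nat N \<partial>circle_measure)"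
      unfolding w_def by simp
    also have "\<dots> = of_nat (N - Suc m) / of_nat N"
      by (subst integral_divide_zero) (simp only: fejer_weight_coefficient)
    finally show ?thesis by simp
  qed
  have X: "X i = (\<integral>z. of_real (w z) * cnj z ^ Suc i * Y i z \<partial>circle_measure)" for i
  proof -
    have "X i = (\<Sum>j<N. \<integral>z. (c (i + j) * l ^ j) * (of_real (w z) * cnj z ^ Suc (i + j)) \<partial>circle_measure)"
      unfolding X_def
    proof (intro sum.cong refl)
      fix j
      have rot: "x * y * z = (y * z) * x" for x y z :: complex by simp
      show "of_real (real (N - Suc (i + j)) / N) * c (i + j) * l ^ j
          = (\<integral>z. (c (i + j) * l ^ j) * (of_real (w z) * cnj z ^ Suc (i + j)) \<partial>circle_measure)"
        unfolding coef by (subst integral_mult_right_zero) (rule rot)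
    qed
    also have "\<dots> = (\<integral>z. (\<Sum>j<N. (c (i + j) * l ^ j) * (of_real (w z) * cnj z ^ Suc (i + j))) \<partial>circle_measure)"
      by (intro Bochner_Integration.integral_sum[symmetric] continuous_imp_circle_integrable continuous_intros w)
    also have "\<dots> = (\<integral>z. of_real (w z) * cnj z ^ Suc i * Y i z \<partial>circle_measure)"
      unfolding Y_def sum_distrib_left by (simp add: power_add power_mult_distrib mult_ac)
    finally show ?thesis .
  qed
  have "of_real T = (\<Sum>i<N. cnj (X i) * X i)"
    unfolding T_def by (simp add: complex_norm_square mult.commute del: of_real_power)
  also have "\<dots> = (\<Sum>i<N. \<integral>z. cnj (X i) * (of_real (w z) * cnj z ^ Suc i * Y i z) \<partial>circle_measure)"
    using X by simp
  also have "\<dots> = (\<integral>z. (\<Sum>i<N. cnj (X i) * (of_real (w z) * cnj z ^ Suc i * Y i z)) \<partial>circle_measure)"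
    by (intro Bochner_Integration.integral_sum[symmetric] continuous_imp_circle_integrable continuous_intros w cY)
  also have "norm \<dots> \<le> (\<integral>z. w z * (sqrt T * (r * sqrt s)) \<partial>circle_measure)"
  proof (rule Bochner_Integration.integral_norm_bound_integral)
    fix z assume "z \<in> space circle_measure"
    then have z: "z \<in> torus" by simp
    have "norm (\<Sum>i<N. cnj (X i) * (of_real (w z) * cnj z ^ Suc i * Y i z))
        = norm (of_real (w z) * (\<Sum>i<N. (cnj (X i) * cnj z ^ Suc i) * Y i z))"
      by (simp add: sum_distrib_left mult_ac)
    also have "\<dots> = w z * norm (\<Sum>i<N. (cnj (X i) * cnj z ^ Suc i) * Y i z)"
      using w(2)[of z] by (simp add: norm_mult)
    also have "\<dots> \<le> w z * (sqrt (\<Sum>i<N. (norm (cnj (X i) * cnj z ^ Suc i))\<^sup>2) * sqrt (\<Sum>i<N. (norm (Y i z))\<^sup>2))"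
      by (intro mult_left_mono norm_sum_mult_le_sqrt w)
    also have "(\<Sum>i<N. (norm (cnj (X i) * cnj z ^ Suc i))\<^sup>2) = T"
      unfolding T_def using z by (simp add: norm_mult norm_power)
    also have "w z * (sqrt T * sqrt (\<Sum>i<N. (norm (Y i z))\<^sup>2)) \<le> w z * (sqrt T * sqrt (r\<^sup>2 * s))"
      by (intro mult_left_mono w real_sqrt_le_mono Yle z) (simp add: T0)
    also have "sqrt (r\<^sup>2 * s) = r * sqrt s" using r by (simp add: real_sqrt_mult)
    finally show "norm (\<Sum>i<N. cnj (X i) * (of_real (w z) * cnj z ^ Suc i * Y i z)) \<le> w z * (sqrt T * (r * sqrt s))" .
  qed (intro continuous_imp_circle_integrable continuous_intros w cY)+
  also have "\<dots> = sqrt T * (r * sqrt s)" using w(3) by simp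
  finally have "T \<le> sqrt T * (r * sqrt s)" using T0 by simp
  then have "sqrt T * sqrt T \<le> sqrt T * (r * sqrt s)" using T0 by simp
  then have "sqrt T \<le> r * sqrt s"
  proof (cases "T = 0")
    case False
    then have "sqrt T > 0" using T0 by simp
    then show ?thesis
      using \<open>sqrt T * sqrt T \<le> sqrt T * (r * sqrt s)\<close> by (simp only: mult_le_cancel_left_pos)
  qed (use T0 r in simp)
  then have "(sqrt T)\<^sup>2 \<le> (r * sqrt s)\<^sup>2" using T0 by (intro power_mono) auto
  then have "T \<le> r\<^sup>2 * s" using T0 by (simp add: power_mult_distrib)
  then show "(\<Sum>i<N. (norm (\<Sum>j<N. of_real (real (N - Suc (i + j)) / N) * c (i + j) * l ^ j))\<^sup>2)
      \<le> r\<^sup>2 * (\<Sum>j<N. (norm l) ^ (2 * j))"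
    unfolding T_def X_def s_def .
qed

text \<open>
The weight vanishes for \<open>m \<ge> N - 1\<close>, so a square of size \<open>N\<close> contains the complete Hankel matrix.
\<close>
lemma edge_pairing_le:
  assumes N: "N \<ge> 1" and r: "r \<ge> 0" and test: "kernel_test N c r"
  shows "norm (\<Sum>m\<le>d. of_real (real (N - Suc m) / N) * c m * q m)
     \<le> 9 * r * (\<integral>z. norm (\<Sum>m\<le>d. q m * z ^ m) \<partial>circle_measure)"
proof (rule hankel_pairing_le[where n = N, OF _ r])
  show "of_real (real (N - Suc m) / N) * c m = 0" if "m \<ge> N" for m using that by simp
  fix l :: complex assume l: "norm l < 1"
  let ?s = "\<Sum>j<N. (norm l) ^ (2 * j)"
  have pos: "1 - (norm l)\<^sup>2 \<ge> 0" using l by (simp add: power_le_one)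
  have "(1 - (norm l)\<^sup>2) * (\<Sum>i<N. (norm (\<Sum>j<N. of_real (real (N - Suc (i + j)) / N) * c (i + j) * l ^ j))\<^sup>2)
      \<le> (1 - (norm l)\<^sup>2) * (r\<^sup>2 * ?s)"
    using kernel_test_edge[OF assms] l pos unfolding kernel_test_def by (intro mult_left_mono) auto
  also have "\<dots> = r\<^sup>2 * (1 - ((norm l)\<^sup>2) ^ N)"
    using one_diff_power_eq[of "(norm l)\<^sup>2" N] by (simp add: power_mult)
  also have "\<dots> \<le> r\<^sup>2" by (simp add: mult_left_le)
  finally show "(1 - (norm l)\<^sup>2) * (\<Sum>i<N. (norm (\<Sum>j<N. of_real (real (N - Suc (i + j)) / N) * c (i + j) * l ^ j))\<^sup>2) \<le> r\<^sup>2" .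
qed

lemma kernel_test_closed_disc:
  assumes test: "kernel_test N c r" and l: "norm l \<le> 1"
  shows "(\<Sum>i<N. (norm (\<Sum>j<N. c (i + j) * l ^ j))\<^sup>2) \<le> r\<^sup>2 * (\<Sum>j<N. (norm l) ^ (2 * j))"
proof -
  let ?S = "{l. (\<Sum>i<N. (norm (\<Sum>j<N. c (i + j) * l ^ j))\<^sup>2) \<le> r\<^sup>2 * (\<Sum>j<N. (norm l) ^ (2 * j))}"
  have "closed ?S" by (intro closed_Collect_le continuous_intros)
  moreover have "ball 0 1 \<subseteq> ?S" using test unfolding kernel_test_def by auto
  ultimately have "closure (ball 0 1) \<subseteq> ?S" by (rule closure_minimal[rotated])
  moreover have "l \<in> closure (ball 0 1)" using l by simp
  ultimately show ?thesis by blast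
qed

text \<open>
The number of entries of an \<open>N\<close> by \<open>N\<close> matrix with \<open>i + j = m\<close> is written as \<open>N\<close> minus the two ramps, one of
which is always zero by truncated subtraction.
\<close>
lemma sum_antidiagonals:
  fixes x :: "nat \<Rightarrow> complex"
  assumes "N \<ge> 1"
  shows "(\<Sum>i<N. \<Sum>j<N. x (i + j)) = (\<Sum>m\<le>2*N-2. of_nat (N - ((N - Suc m) + (m - (N - 1)))) * x m)"
proof -
  have "(\<Sum>i<N. \<Sum>j<N. x (i + j)) = (\<Sum>i<N. \<Sum>m\<in>{m\<in>{..2*N-2}. i \<le> m \<and> m < i + N}. x m)"
  proof (rule sum.cong[OF refl])
    fix i assume "i \<in> {..<N}"
    then show "(\<Sum>j<N. x (i + j)) = (\<Sum>m\<in>{m\<in>{..2*N-2}. i \<le> m \<and> m < i + N}. x m)"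
      by (intro sum.reindex_bij_witness[of _ "\<lambda>m. m - i" "\<lambda>j. i + j"]) auto
  qed
  also have "\<dots> = (\<Sum>m\<le>2*N-2. \<Sum>i\<in>{i\<in>{..<N}. i \<le> m \<and> m < i + N}. x m)"
    by (rule sum.swap_restrict) auto
  also have "\<dots> = (\<Sum>m\<le>2*N-2. of_nat (N - ((N - Suc m) + (m - (N - 1)))) * x m)"
  proof (intro sum.cong refl)
    fix m assume m: "m \<in> {..2*N-2}"
    have "{i\<in>{..<N}. i \<le> m \<and> m < i + N} = {Suc m - N..<min N (Suc m)}" using assms by auto
    then have "card {i\<in>{..<N}. i \<le> m \<and> m < i + N} = N - ((N - Suc m) + (m - (N - 1)))"
      using m assms by simp
    then show "(\<Sum>i\<in>{i\<in>{..<N}. i \<le> m \<and> m < i + N}. x m) = of_nat (N - ((N - Suc m) + (m - (N - 1)))) * x m"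
      by simp
  qed
  finally show ?thesis .
qed

text \<open>
The left-hand side is the integral of the polynomial with coefficients \<open>q\<close> against a function which, at a
point \<open>z\<close> of the circle, is the bilinear form of the matrix at the two vectors \<open>(cnj z ^ i)\<close>. Both have norm
\<open>sqrt N\<close>, so the function is bounded by \<open>N * r\<close>.
\<close>
lemma middle_pairing_le:
  assumes N: "N \<ge> 1" and r: "r \<ge> 0" and test: "kernel_test N c r"
  shows "norm (\<Sum>i<N. \<Sum>j<N. c (i + j) * q (i + j))
     \<le> N * r * (\<integral>z. norm (\<Sum>m\<le>2*N-2. q m * z ^ m) \<partial>circle_measure)"
proof -
  define n where "n m = (of_nat (N - ((N - Suc m) + (m - (N - 1)))) :: complex)" for m
  define f where "f z = (\<Sum>m\<le>2*N-2. q m * z ^ m)" for z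
  define p where "p z = (\<Sum>m\<le>2*N-2. cnj (n m * c m) * z ^ m)" for z
  have c: "continuous_on A f" "continuous_on A p" for A
    unfolding f_def[abs_def] p_def[abs_def] by (intro continuous_intros)+
  have p_le: "norm (p z) \<le> N * r" if z: "z \<in> torus" for z
  proof -
    have "cnj (p z) = (\<Sum>m\<le>2*N-2. n m * (c m * cnj z ^ m))"
      unfolding p_def by (simp add: mult.assoc)
    also have "\<dots> = (\<Sum>i<N. \<Sum>j<N. c (i + j) * cnj z ^ (i + j))"
      unfolding n_def using sum_antidiagonals[OF N, of "\<lambda>m. c m * cnj z ^ m"] by simp
    also have "\<dots> = (\<Sum>i<N. cnj z ^ i * (\<Sum>j<N. c (i + j) * cnj z ^ j))"
      by (simp add: sum_distrib_left power_add mult_ac)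
    finally have "norm (p z) = norm (\<Sum>i<N. cnj z ^ i * (\<Sum>j<N. c (i + j) * cnj z ^ j))"
      by (metis complex_mod_cnj)
    also have "\<dots> \<le> sqrt (\<Sum>i<N. (norm (cnj z ^ i))\<^sup>2) * sqrt (\<Sum>i<N. (norm (\<Sum>j<N. c (i + j) * cnj z ^ j))\<^sup>2)"
      by (rule norm_sum_mult_le_sqrt)
    also have "\<dots> \<le> sqrt N * sqrt (r\<^sup>2 * N)"
      using kernel_test_closed_disc[OF test, of "cnj z"] z
      by (intro mult_mono real_sqrt_le_mono) (auto simp: norm_power intro!: sum_nonneg)
    also have "\<dots> = N * r" using r by (simp add: real_sqrt_mult)
    finally show ?thesis .
  qed
  have "(\<Sum>i<N. \<Sum>j<N. c (i + j) * q (i + j)) = (\<Sum>m\<le>2*N-2. q m * cnj (cnj (n m * c m)))"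
    unfolding n_def using sum_antidiagonals[OF N, of "\<lambda>m. c m * q m"] by (simp add: mult_ac)
  also have "\<dots> = (\<integral>z. f z * cnj (p z) \<partial>circle_measure)"
    unfolding f_def p_def by (subst circle_inner_polynomials) auto
  also have "norm \<dots> \<le> (\<integral>z. N * r * norm (f z) \<partial>circle_measure)"
  proof (rule Bochner_Integration.integral_norm_bound_integral)
    fix z assume "z \<in> space circle_measure"
    then have "norm (f z) * norm (p z) \<le> norm (f z) * (N * r)"
      by (intro mult_left_mono p_le) auto
    then show "norm (f z * cnj (p z)) \<le> N * r * norm (f z)" by (simp add: norm_mult mult.commute)
  qed (intro continuous_imp_circle_integrable continuous_intros c)+
  finally show ?thesis unfolding f_def by simp
qed

lemma toeplitz_pairing_le:
  assumes N: "N \<ge> 1" and r: "r \<ge> 0" 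
    and test: "kernel_test N c r" "kernel_test N (\<lambda>m. c (2*N-2-m)) r"
  shows "norm (\<Sum>m\<le>2*N-2. c m * q m) \<le> 19 * r * (\<integral>z. norm (\<Sum>m\<le>2*N-2. q m * z ^ m) \<partial>circle_measure)"
proof -
  let ?d = "2*N-2"
  define I where "I = (\<integral>z. norm (\<Sum>m\<le>?d. q m * z ^ m) \<partial>circle_measure)"
  define A where "A = (\<Sum>m\<le>?d. of_real (real (N - Suc m) / N) * c m * q m)"
  define B where "B = (\<Sum>m\<le>?d. of_real (real (m - (N - 1)) / N) * c m * q m)"
  define M where "M = (\<Sum>i<N. \<Sum>j<N. c (i + j) * q (i + j))"
  have A: "norm A \<le> 9 * r * I" unfolding A_def I_def by (rule edge_pairing_le[OF N r test(1)])
  \<comment> \<open>reversal of both sequences; conjugation keeps the modulus of the polynomial on the circle unchanged\<close>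
  have B: "norm B \<le> 9 * r * I"
  proof -
    have "kernel_test N (\<lambda>m. cnj (c (?d - m))) r"
      unfolding kernel_test_def
    proof (intro allI impI)
      fix l :: complex assume l: "norm l < 1"
      have conj: "(\<Sum>j<N. cnj (c (?d - (i + j))) * l ^ j) = cnj (\<Sum>j<N. c (?d - (i + j)) * cnj l ^ j)" for i
        by simp
      show "(\<Sum>i<N. (norm (\<Sum>j<N. cnj (c (?d - (i + j))) * l ^ j))\<^sup>2) \<le> r\<^sup>2 * (\<Sum>j<N. (norm l) ^ (2 * j))"
        using test(2)[unfolded kernel_test_def, rule_format, of "cnj l"] l
        unfolding conj complex_mod_cnj by simp
    qed
    from edge_pairing_le[OF N r this, where d = ?d and q = "\<lambda>m. cnj (q (?d - m))"]
    have "norm (\<Sum>m\<le>?d. of_real (real (N - Suc m) / N) * cnj (c (?d - m)) * cnj (q (?d - m)))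
        \<le> 9 * r * (\<integral>z. norm (\<Sum>m\<le>?d. cnj (q (?d - m)) * z ^ m) \<partial>circle_measure)" .
    also have "(\<Sum>m\<le>?d. of_real (real (N - Suc m) / N) * cnj (c (?d - m)) * cnj (q (?d - m))) = cnj B"
    proof -
      have "B = (\<Sum>m\<le>?d. of_real (real ((?d - m) - (N - 1)) / N) * c (?d - m) * q (?d - m))"
        unfolding B_def atMost_atLeast0 by (subst sum.atLeastAtMost_rev) simp
      also have "\<dots> = (\<Sum>m\<le>?d. of_real (real (N - Suc m) / N) * c (?d - m) * q (?d - m))"
      proof -
        have "(?d - m) - (N - 1) = N - Suc m" for m using N by simp
        then show ?thesis by simp
      qed
      finally show ?thesis by simp
    qed
    also have "(\<integral>z. norm (\<Sum>m\<le>?d. cnj (q (?d - m)) * z ^ m) \<partial>circle_measure) = I"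
      unfolding I_def
    proof (rule Bochner_Integration.integral_cong)
      fix z :: complex assume "z \<in> space circle_measure"
      then have z: "norm z = 1" by simp
      have zz: "z ^ k * cnj z ^ k = 1" for k using z by (intro torus_cnj_power_cancel) simp
      have "(\<Sum>m\<le>d. cnj (q (d - m)) * z ^ m) = (\<Sum>m\<le>d. cnj (q m) * z ^ (d - m))" for d
        by (rule sum.reindex_bij_witness[of _ "\<lambda>m. d - m" "\<lambda>m. d - m"]) auto
      then have "(\<Sum>m\<le>?d. cnj (q (?d - m)) * z ^ m) = (\<Sum>m\<le>?d. cnj (q m) * z ^ (?d - m))" .
      also have "\<dots> = (\<Sum>m\<le>?d. z ^ ?d * cnj (q m * z ^ m))"
      proof (intro sum.cong refl)
        fix m assume "m \<in> {..?d}"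
        then have "z ^ ?d = z ^ (?d - m) * z ^ m" by (simp only: power_add[symmetric] atMost_iff le_add_diff_inverse2)
        then have "z ^ ?d * cnj (q m * z ^ m) = z ^ (?d - m) * (z ^ m * cnj z ^ m) * cnj (q m)"
          by (simp only: complex_cnj_mult complex_cnj_power mult_ac)
        then show "cnj (q m) * z ^ (?d - m) = z ^ ?d * cnj (q m * z ^ m)"
          unfolding zz by (simp only: mult_1_right) (rule mult.commute)
      qed
      also have "\<dots> = z ^ ?d * cnj (\<Sum>m\<le>?d. q m * z ^ m)" by (simp add: sum_distrib_left)
      finally show "norm (\<Sum>m\<le>?d. cnj (q (?d - m)) * z ^ m) = norm (\<Sum>m\<le>?d. q m * z ^ m)"
        using z by (simp only: norm_mult norm_power complex_mod_cnj) simp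
    qed simp
    finally show ?thesis by simp
  qed
  have M: "norm M \<le> N * r * I" unfolding M_def I_def by (rule middle_pairing_le[OF N r test(1)])
  have "(\<Sum>m\<le>?d. c m * q m) = A + B + M / N"
  proof -
    have "A + B + M / N = (\<Sum>m\<le>?d. (of_real (real (N - Suc m) / N) + of_real (real (m - (N - 1)) / N) +
         of_nat (N - ((N - Suc m) + (m - (N - 1)))) / N) * (c m * q m))"
      unfolding A_def B_def M_def sum_antidiagonals[OF N, of "\<lambda>m. c m * q m"]
      by (simp add: sum.distrib sum_divide_distrib algebra_simps)
    also have "\<dots> = (\<Sum>m\<le>?d. 1 * (c m * q m))"
    proof (intro sum.cong refl arg_cong2[of _ _ _ _ "(*)"])
      fix m assume m: "m \<in> {..?d}"
      have "(N - Suc m) + (m - (N - 1)) + (N - ((N - Suc m) + (m - (N - 1)))) = N"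
        using N m by auto
      then have "(of_nat (N - Suc m) + of_nat (m - (N - 1)) + of_nat (N - ((N - Suc m) + (m - (N - 1)))) :: complex) = of_nat N"
        by (simp only: flip: of_nat_add)
      then show "of_real (real (N - Suc m) / N) + of_real (real (m - (N - 1)) / N) +
         of_nat (N - ((N - Suc m) + (m - (N - 1)))) / N = (1::complex)"
        using N by (simp flip: add_divide_distrib)
    qed
    finally show ?thesis by simp
  qed
  then have "norm (\<Sum>m\<le>?d. c m * q m) \<le> norm A + norm B + norm M / N"
    using norm_triangle_ineq[of "A + B" "M / N"] norm_triangle_ineq[of A B] by (simp add: norm_divide)
  also have "\<dots> \<le> 9 * r * I + 9 * r * I + r * I"
    using A B M N by (intro add_mono) (simp_all add: divide_le_eq mult_ac)
  finally show ?thesis unfolding I_def by simp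
qed

lemma bounded_toeplitz_symbol:
  assumes N: "N \<ge> 1" and r: "r \<ge> 0" 
    and test: "kernel_test N c r" "kernel_test N (\<lambda>m. c (2*N-2-m)) r"
  obtains \<psi> where "continuous_on torus \<psi>" "\<And>z. z \<in> torus \<Longrightarrow> norm (\<psi> z) \<le> 38 * r"
    "\<And>m. m \<le> 2*N-2 \<Longrightarrow> (\<integral>z. \<psi> z * z ^ m \<partial>circle_measure) = c m"
  using symbol_of_bounded_pairing[OF _ toeplitz_pairing_le[OF N r test]] r by auto

section \<open>Boundary values of functions in the Hardy space\<close>

lemma L2_imp_circle_integrable:
  assumes "f \<in> L2" shows "integrable circle_measure f"
proof (rule Bochner_Integration.integrable_bound)
  show "integrable circle_measure (\<lambda>z. 1 + (norm (f z))\<^sup>2)" "f \<in> borel_measurable circle_measure"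
    using assms by (auto simp: L2_def)
  have "x \<le> 1 + x\<^sup>2" for x :: real
    using zero_le_power2[of "x - 1/2"] by (simp add: power2_eq_square algebra_simps)
  then show "AE z in circle_measure. norm (f z) \<le> norm (1 + (norm (f z))\<^sup>2)" by simp
qed

lemma continuous_imp_L2: "continuous_on torus f \<Longrightarrow> f \<in> L2"
  unfolding L2_def
  by (auto intro!: continuous_imp_circle_measurable continuous_imp_circle_integrable continuous_intros)

lemma integrable_mult_continuous:
  fixes f g :: "complex \<Rightarrow> complex"
  assumes f: "integrable circle_measure f" and g: "continuous_on torus g"
  shows "integrable circle_measure (\<lambda>z. f z * g z)"
proof -
  obtain B where B: "\<And>z. z \<in> torus \<Longrightarrow> norm (g z) \<le> B" using continuous_imp_circle_bounded[OF g] by blast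
  show ?thesis
  proof (rule Bochner_Integration.integrable_bound)
    show "integrable circle_measure (\<lambda>z. B * norm (f z))" using f by simp
    show "(\<lambda>z. f z * g z) \<in> borel_measurable circle_measure"
      using f continuous_imp_circle_measurable[OF g] by measurable
    have "norm (f z * g z) \<le> B * norm (f z)" if "z \<in> torus" for z
      using mult_left_mono[OF B[OF that], of "norm (f z)"] by (simp add: norm_mult mult.commute)
    then show "AE z in circle_measure. norm (f z * g z) \<le> norm (B * norm (f z))"
      by (intro AE_I2) (auto intro: order_trans[OF _ abs_ge_self])
  qed
qed

text \<open>
The inequality \<open>g \<le> min g R + g\<^sup>2 / R\<close> reduces the claim to dominated convergence for the truncated functions,
with an error of at most \<open>B / R\<close>.
\<close>
lemma L1_limit_of_L2_bounded:
  fixes g :: "nat \<Rightarrow> complex \<Rightarrow> real"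
  assumes m: "\<And>n. g n \<in> borel_measurable circle_measure" and nn: "\<And>n z. g n z \<ge> 0"
    and int: "\<And>n. integrable circle_measure (\<lambda>z. (g n z)\<^sup>2)" and B: "\<And>n. (\<integral>z. (g n z)\<^sup>2 \<partial>circle_measure) \<le> B"
    and lim: "AE z in circle_measure. (\<lambda>n. g n z) \<longlonglongrightarrow> 0"
  shows "(\<lambda>n. \<integral>z. g n z \<partial>circle_measure) \<longlonglongrightarrow> 0"
proof (rule LIMSEQ_I)
  fix e :: real assume e: "e > 0"
  have B0: "B \<ge> 0" using order_trans[OF Bochner_Integration.integral_nonneg B[of 0]] by simp
  define R where "R = 2 * (B + 1) / e"
  have R: "R > 0" using e B0 by (simp add: R_def)
  have mi: "integrable circle_measure (\<lambda>z. min (g n z) R)" for n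
    using m nn R by (intro circle.integrable_const_bound[of _ R]) (auto intro!: AE_I2)
  have "(\<lambda>n. \<integral>z. min (g n z) R \<partial>circle_measure) \<longlonglongrightarrow> (\<integral>z. 0 \<partial>circle_measure)"
  proof (rule integral_dominated_convergence[where w = "\<lambda>_. R"])
    show "AE z in circle_measure. (\<lambda>n. min (g n z) R) \<longlonglongrightarrow> 0"
      using lim
    proof eventually_elim
      case (elim z)
      from tendsto_min[OF elim tendsto_const[of R]] R show ?case by simp
    qed
    show "AE z in circle_measure. norm (min (g n z) R) \<le> R" for n using nn R by (intro AE_I2) auto
  qed (use m in auto)
  then obtain n0 where n0: "\<And>n. n \<ge> n0 \<Longrightarrow> norm (\<integral>z. min (g n z) R \<partial>circle_measure) < e / 2"
    using e LIMSEQ_D[of "\<lambda>n. \<integral>z. min (g n z) R \<partial>circle_measure" 0 "e/2"] by auto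
  have "norm (\<integral>z. g n z \<partial>circle_measure) < e" if n: "n \<ge> n0" for n
  proof -
    have "(\<integral>z. g n z \<partial>circle_measure) \<le> (\<integral>z. min (g n z) R + (g n z)\<^sup>2 / R \<partial>circle_measure)"
    proof (rule integral_mono')
      show "integrable circle_measure (\<lambda>z. min (g n z) R + (g n z)\<^sup>2 / R)" using mi int by simp
      fix z
      show "0 \<le> min (g n z) R + (g n z)\<^sup>2 / R" using nn[of n z] R by simp
      show "g n z \<le> min (g n z) R + (g n z)\<^sup>2 / R"
      proof (cases "g n z \<le> R")
        case False
        then have "g n z * R \<le> g n z * g n z" using nn[of n z] by (intro mult_left_mono) auto
        then have "g n z \<le> (g n z)\<^sup>2 / R" using R by (simp add: le_divide_eq power2_eq_square)
        then show ?thesis using nn[of n z] R by simp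
      qed (use R in simp)
    qed
    also have "\<dots> = (\<integral>z. min (g n z) R \<partial>circle_measure) + (\<integral>z. (g n z)\<^sup>2 \<partial>circle_measure) / R"
      using mi int by simp
    also have "(\<integral>z. (g n z)\<^sup>2 \<partial>circle_measure) / R \<le> B / R" using B R by (intro divide_right_mono) auto
    also have "B / R \<le> e / 2" unfolding R_def using B0 e by (simp add: field_simps)
    finally have "(\<integral>z. g n z \<partial>circle_measure) < e" using n0[OF n] by simp
    moreover have "(\<integral>z. g n z \<partial>circle_measure) \<ge> 0" using nn by (intro integral_nonneg_AE) auto
    ultimately show ?thesis by simp
  qed
  then show "\<exists>no. \<forall>n\<ge>no. norm ((\<integral>z. g n z \<partial>circle_measure) - 0) < e" by auto
qed

lemma H2_weak_limit:
  assumes f: "f \<in> L2" and F: "F holomorphic_on ball 0 1"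
    and bdd: "bdd_above ((\<lambda>r. L2_norm (\<lambda>z. F (of_real r * z))) ` {0..<1})"
    and bv: "has_boundary_values F f" and h: "continuous_on torus h"
    and r: "\<And>k. 0 < r k" "\<And>k. r k < 1" "r \<longlonglongrightarrow> 1"
  shows "(\<lambda>k. \<integral>z. F (of_real (r k) * z) * h z \<partial>circle_measure) \<longlonglongrightarrow> (\<integral>z. f z * h z \<partial>circle_measure)"
proof -
  let ?F = "\<lambda>k z. F (of_real (r k) * z)"
  have cF: "continuous_on torus (?F k)" for k
    using r(1,2)[of k] by (intro continuous_on_compose2[OF holomorphic_on_imp_continuous_on[OF F]] continuous_intros)
      (auto simp: norm_mult)
  obtain B where B': "\<And>s. s \<in> {0..<1} \<Longrightarrow> L2_norm (\<lambda>z. F (of_real s * z)) \<le> B"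
    using bdd unfolding bdd_above_def by blast
  have B: "L2_norm (?F k) \<le> B" for k using B'[of "r k"] r(1,2)[of k] by simp
  have iF: "integrable circle_measure (\<lambda>z. (norm (?F k z))\<^sup>2)" for k
    by (intro continuous_imp_circle_integrable continuous_intros cF)
  have fm: "f \<in> borel_measurable circle_measure" and if2: "integrable circle_measure (\<lambda>z. (norm (f z))\<^sup>2)"
    using f by (auto simp: L2_def)
  have Fm: "?F k \<in> borel_measurable circle_measure" for k by (rule continuous_imp_circle_measurable[OF cF])
  define g where "g k z = norm (?F k z - f z)" for k z
  have sq: "(norm (a - b))\<^sup>2 \<le> 2 * (norm a)\<^sup>2 + 2 * (norm b)\<^sup>2" for a b :: complex
  proof -
    have "(norm (a - b))\<^sup>2 \<le> (norm a + norm b)\<^sup>2" by (intro power_mono norm_triangle_ineq4) auto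
    also have "\<dots> \<le> 2 * (norm a)\<^sup>2 + 2 * (norm b)\<^sup>2"
      using sum_squares_bound[of "norm a" "norm b"] by (simp add: power2_sum)
    finally show ?thesis .
  qed
  have ig2: "integrable circle_measure (\<lambda>z. (g k z)\<^sup>2)" for k
  proof (rule Bochner_Integration.integrable_bound)
    show "integrable circle_measure (\<lambda>z. 2 * (norm (?F k z))\<^sup>2 + 2 * (norm (f z))\<^sup>2)" using iF if2 by simp
    show "(\<lambda>z. (g k z)\<^sup>2) \<in> borel_measurable circle_measure" unfolding g_def using fm Fm by measurable
  qed (use sq in \<open>auto simp: g_def intro!: AE_I2\<close>)
  have lim: "(\<lambda>k. \<integral>z. g k z \<partial>circle_measure) \<longlonglongrightarrow> 0"
  proof (rule L1_limit_of_L2_bounded[OF _ _ ig2])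
    show "g k \<in> borel_measurable circle_measure" for k unfolding g_def using fm Fm by measurable
    show "g k z \<ge> 0" for k z by (simp add: g_def)
    show "(\<integral>z. (g k z)\<^sup>2 \<partial>circle_measure) \<le> 2 * B\<^sup>2 + 2 * (\<integral>z. (norm (f z))\<^sup>2 \<partial>circle_measure)" for k
    proof -
      have "(\<integral>z. (g k z)\<^sup>2 \<partial>circle_measure) \<le> (\<integral>z. 2 * (norm (?F k z))\<^sup>2 + 2 * (norm (f z))\<^sup>2 \<partial>circle_measure)"
        using iF if2 ig2 sq by (intro integral_mono) (auto simp: g_def)
      also have "\<dots> = 2 * (\<integral>z. (norm (?F k z))\<^sup>2 \<partial>circle_measure) + 2 * (\<integral>z. (norm (f z))\<^sup>2 \<partial>circle_measure)"
        using iF[of k] if2 by simp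
      also have "(\<integral>z. (norm (?F k z))\<^sup>2 \<partial>circle_measure) = (L2_norm (?F k))\<^sup>2"
        unfolding L2_norm_def by simp
      also have "\<dots> \<le> B\<^sup>2" by (intro power_mono B) (simp add: L2_norm_def)
      finally show ?thesis by simp
    qed
    have "r k \<in> {..<1} \<and> r k \<noteq> 1" for k using r(2)[of k] by simp
    then have fl: "filterlim r (at_left 1) sequentially" using r(3) by (simp add: filterlim_at)
    show "AE z in circle_measure. (\<lambda>k. g k z) \<longlonglongrightarrow> 0"
      using bv unfolding has_boundary_values_def
    proof eventually_elim
      case (elim z)
      have "(\<lambda>k. ?F k z) \<longlonglongrightarrow> f z" by (rule filterlim_compose[OF elim fl])
      then show ?case unfolding g_def by (simp add: tendsto_norm_zero LIM_zero)
    qed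
  qed
  obtain C where C: "C > 0" "\<And>z. z \<in> torus \<Longrightarrow> norm (h z) \<le> C" using continuous_imp_circle_bounded[OF h] by blast
  define D where "D k = (\<integral>z. ?F k z * h z \<partial>circle_measure) - (\<integral>z. f z * h z \<partial>circle_measure)" for k
  have D_le: "norm (D k) \<le> C * (\<integral>z. g k z \<partial>circle_measure)" for k
  proof -
    have iF1: "integrable circle_measure (?F k)" by (rule continuous_imp_circle_integrable[OF cF])
    have if1: "integrable circle_measure f" by (rule L2_imp_circle_integrable[OF f])
    note ih = integrable_mult_continuous[OF iF1 h] integrable_mult_continuous[OF if1 h]
    have "D k = (\<integral>z. ?F k z * h z - f z * h z \<partial>circle_measure)"
      unfolding D_def by (rule Bochner_Integration.integral_diff[OF ih, symmetric])
    moreover have "norm (\<integral>z. ?F k z * h z - f z * h z \<partial>circle_measure) \<le> (\<integral>z. C * g k z \<partial>circle_measure)"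
    proof (rule Bochner_Integration.integral_norm_bound_integral)
      show "integrable circle_measure (\<lambda>z. ?F k z * h z - f z * h z)"
        by (rule Bochner_Integration.integrable_diff[OF ih])
      show "integrable circle_measure (\<lambda>z. C * g k z)"
        unfolding g_def
        by (intro integrable_mult_right integrable_norm Bochner_Integration.integrable_diff iF1 if1)
      fix z assume "z \<in> space circle_measure"
      then have "norm (h z) \<le> C" by (intro C) simp
      then have "norm (?F k z - f z) * norm (h z) \<le> norm (?F k z - f z) * C" by (rule mult_left_mono) simp
      moreover have "norm (?F k z * h z - f z * h z) = norm (?F k z - f z) * norm (h z)"
        by (simp only: left_diff_distrib[symmetric] norm_mult)
      moreover have "norm (?F k z - f z) * C = C * g k z" unfolding g_def by (rule mult.commute)
      ultimately show "norm (?F k z * h z - f z * h z) \<le> C * g k z" by linarith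
    qed
    ultimately show ?thesis by simp
  qed
  have "(\<lambda>k. C * (\<integral>z. g k z \<partial>circle_measure)) \<longlonglongrightarrow> 0" by (rule tendsto_mult_right_zero[OF lim])
  with always_eventually[OF allI, OF D_le] have "D \<longlonglongrightarrow> 0" by (rule Lim_null_comparison)
  then show ?thesis unfolding D_def[abs_def] by (rule LIM_zero_cancel)
qed

text \<open>
The coefficients of the dilations \<open>F (r * z)\<close> are given by Cauchy's formula, and they converge to those of the
boundary function as \<open>r\<close> tends to \<open>1\<close>.
\<close>
lemma H2_Fourier_coefficients:
  assumes f: "f \<in> L2" and F: "F holomorphic_on ball 0 1"
    and bdd: "bdd_above ((\<lambda>r. L2_norm (\<lambda>z. F (of_real r * z))) ` {0..<1})"
    and bv: "has_boundary_values F f"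
  shows "(\<integral>z. f z * cnj z ^ n \<partial>circle_measure) = (deriv ^^ n) F 0 / fact n"
    and "n \<ge> 1 \<Longrightarrow> (\<integral>z. f z * z ^ n \<partial>circle_measure) = 0"
proof -
  define r :: "nat \<Rightarrow> real" where "r k = 1 - 1 / real (k + 2)" for k
  have r: "0 < r k" "r k < 1" for k unfolding r_def by (auto simp: field_simps)
  have "(\<lambda>k. 1 / real (k + 2)) \<longlonglongrightarrow> 0"
    using LIMSEQ_ignore_initial_segment[OF lim_1_over_n, of 2] by simp
  from tendsto_diff[OF tendsto_const[of 1] this] have rl: "r \<longlonglongrightarrow> 1" unfolding r_def[abs_def] by simp
  note weak = H2_weak_limit[OF f F bdd bv _ r rl]
  let ?c = "(deriv ^^ n) F 0 / fact n"
  have "(\<lambda>k. \<integral>z. F (of_real (r k) * z) * cnj z ^ n \<partial>circle_measure) \<longlonglongrightarrow> (\<integral>z. f z * cnj z ^ n \<partial>circle_measure)"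
    by (rule weak) (intro continuous_intros)
  moreover have "(\<integral>z. F (of_real (r k) * z) * cnj z ^ n \<partial>circle_measure) = of_real (r k ^ n) * ?c" for k
    by (rule Taylor_coefficient_eq_circle_integral[OF F r])
  moreover have "(\<lambda>k. of_real (r k ^ n) * ?c) \<longlonglongrightarrow> of_real (1 ^ n) * ?c" by (intro tendsto_intros rl)
  ultimately have "(\<integral>z. f z * cnj z ^ n \<partial>circle_measure) = of_real (1 ^ n) * ?c"
    using LIMSEQ_unique by simp
  then show "(\<integral>z. f z * cnj z ^ n \<partial>circle_measure) = ?c" by simp
  assume n: "n \<ge> 1"
  have "(\<lambda>k. \<integral>z. F (of_real (r k) * z) * z ^ n \<partial>circle_measure) \<longlonglongrightarrow> (\<integral>z. f z * z ^ n \<partial>circle_measure)"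
    by (rule weak) (intro continuous_intros)
  moreover have "(\<integral>z. F (of_real (r k) * z) * z ^ n \<partial>circle_measure) = 0" for k
    by (rule circle_integral_power_mult_holomorphic[OF F r n])
  ultimately show "(\<integral>z. f z * z ^ n \<partial>circle_measure) = 0" by (simp add: LIMSEQ_const_iff)
qed

section \<open>The model space of a power\<close>

lemma polynomial_in_H2: "(\<lambda>z. \<Sum>i\<in>A. c i * z ^ i) \<in> H2"
proof -
  let ?f = "\<lambda>z. \<Sum>i\<in>A. c i * z ^ i"
  have c: "continuous_on S ?f" for S by (intro continuous_intros)
  have "bdd_above ((\<lambda>r. L2_norm (\<lambda>z. ?f (of_real r * z))) ` {0..<1})"
  proof (rule bdd_aboveI2)
    fix r :: real assume r: "r \<in> {0..<1}"
    let ?B = "\<Sum>i\<in>A. norm (c i)"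
    have "norm (?f (of_real r * z)) \<le> ?B" if "z \<in> torus" for z
      using that r by (intro sum_norm_le) (auto simp: norm_mult norm_power power_le_one intro!: mult_left_le)
    then have "(\<integral>z. (norm (?f (of_real r * z)))\<^sup>2 \<partial>circle_measure) \<le> (\<integral>z. ?B\<^sup>2 \<partial>circle_measure)"
      by (intro integral_mono continuous_imp_circle_integrable continuous_intros power_mono) auto
    then show "L2_norm (\<lambda>z. ?f (of_real r * z)) \<le> ?B"
      unfolding L2_norm_def using circle.prob_space by (intro real_le_lsqrt) (auto intro!: sum_nonneg)
  qed
  moreover have "has_boundary_values ?f ?f"
    unfolding has_boundary_values_def
  proof (rule AE_I2)
    fix z
    have "((\<lambda>r. ?f (of_real r * z)) \<longlongrightarrow> ?f (of_real 1 * z)) (at_left 1)" by (intro tendsto_intros)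
    then show "((\<lambda>r. ?f (of_real r * z)) \<longlongrightarrow> ?f z) (at_left 1)" by simp
  qed
  moreover have "?f holomorphic_on ball 0 1" by (intro holomorphic_intros)
  ultimately show ?thesis unfolding H2_def using continuous_imp_L2[OF c] by blast
qed

text \<open>
The inner product with \<open>z ^ N * g\<close> only involves the Fourier coefficients of \<open>g\<close> of negative index.
\<close>
lemma polynomial_in_model_space_power: "(\<lambda>z. \<Sum>i<N. c i * z ^ i) \<in> model_space (\<lambda>z. z ^ N)"
  unfolding model_space_def
proof (intro CollectI conjI ballI polynomial_in_H2)
  fix g assume g: "g \<in> H2"
  then obtain G where G: "g \<in> L2" "G holomorphic_on ball 0 1"
    "bdd_above ((\<lambda>r. L2_norm (\<lambda>z. G (of_real r * z))) ` {0..<1})" "has_boundary_values G g"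
    unfolding H2_def by blast
  have gi: "integrable circle_measure g" by (rule L2_imp_circle_integrable[OF G(1)])
  have "L2_inner (\<lambda>z. \<Sum>i<N. c i * z ^ i) (\<lambda>z. z ^ N * g z)
      = (\<integral>z. (\<Sum>i<N. c i * cnj (g z * z ^ (N - i))) \<partial>circle_measure)"
    unfolding L2_inner_def
  proof (rule Bochner_Integration.integral_cong)
    fix z assume "z \<in> space circle_measure"
    then have z: "z \<in> torus" by simp
    have "c i * z ^ i * cnj (z ^ N * g z) = c i * cnj (g z * z ^ (N - i))" if "i < N" for i
    proof -
      have "z ^ N = z ^ i * z ^ (N - i)" using that by (simp flip: power_add)
      then have "c i * z ^ i * cnj (z ^ N * g z) = c i * (z ^ i * cnj z ^ i) * cnj (g z * z ^ (N - i))" by simp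
      then show ?thesis unfolding torus_cnj_power_cancel[OF z] by simp
    qed
    then show "(\<Sum>i<N. c i * z ^ i) * cnj (z ^ N * g z) = (\<Sum>i<N. c i * cnj (g z * z ^ (N - i)))"
      unfolding sum_distrib_right by (intro sum.cong) auto
  qed simp
  also have "\<dots> = (\<Sum>i<N. c i * cnj (\<integral>z. g z * z ^ (N - i) \<partial>circle_measure))"
  proof -
    have "integrable circle_measure (\<lambda>z. cnj (g z * z ^ (N - i)))" for i
      by (intro integrable_cnj integrable_mult_continuous gi continuous_intros)
    then show ?thesis by (simp only: Bochner_Integration.integral_sum integrable_mult_right integral_mult_right_zero Bochner_Integration.integral_cnj)
  qed
  also have "\<dots> = 0" using H2_Fourier_coefficients(2)[OF G] by simp
  finally show "L2_inner (\<lambda>z. \<Sum>i<N. c i * z ^ i) (\<lambda>z. z ^ N * g z) = 0" .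
qed

text \<open>
Orthogonality to \<open>z ^ N * z ^ n\<close> kills the Taylor coefficients of index at least \<open>N\<close> of the holomorphic extension.
The extension is thus a polynomial, and so is its boundary function, almost everywhere.
\<close>
lemma model_space_power_polynomial:
  assumes k: "k \<in> model_space (\<lambda>z. z ^ N)"
  shows "AE z in circle_measure. k z = (\<Sum>i<N. (\<integral>w. k w * cnj w ^ i \<partial>circle_measure) * z ^ i)"
proof -
  from k obtain F where F: "k \<in> L2" "F holomorphic_on ball 0 1"
    "bdd_above ((\<lambda>r. L2_norm (\<lambda>z. F (of_real r * z))) ` {0..<1})" "has_boundary_values F k"
    unfolding model_space_def H2_def by blast
  define c where "c i = (\<integral>w. k w * cnj w ^ i \<partial>circle_measure)" for i
  have c: "c i = (deriv ^^ i) F 0 / fact i" for i unfolding c_def by (rule H2_Fourier_coefficients(1)[OF F])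
  have c0: "c i = 0" if "i \<ge> N" for i
  proof -
    have "(\<lambda>z. z ^ (i - N)) \<in> H2" using polynomial_in_H2[of "\<lambda>_. 1" "{i - N}"] by simp
    moreover have "\<forall>g\<in>H2. L2_inner k (\<lambda>z. z ^ N * g z) = 0" using k unfolding model_space_def by blast
    ultimately have "L2_inner k (\<lambda>z. z ^ N * z ^ (i - N)) = 0" by (rule bspec[rotated])
    then show ?thesis unfolding c_def L2_inner_def using that by (simp flip: power_add)
  qed
  have F_eq: "F w = (\<Sum>i<N. c i * w ^ i)" if w: "w \<in> ball 0 1" for w
  proof -
    have "(\<lambda>n. c n * w ^ n) sums F w" using holomorphic_power_series[OF F(2) w] c by simp
    moreover have "(\<lambda>n. c n * w ^ n) sums (\<Sum>i<N. c i * w ^ i)"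
      by (rule sums_finite) (auto simp: c0)
    ultimately show ?thesis by (rule sums_unique2)
  qed
  have "AE z in circle_measure. k z = (\<Sum>i<N. c i * z ^ i)"
    using F(4) unfolding has_boundary_values_def
  proof (rule AE_mp, intro AE_I2 impI)
    fix z assume z: "z \<in> space circle_measure" and lim: "((\<lambda>r. F (of_real r * z)) \<longlongrightarrow> k z) (at_left 1)"
    have lim': "((\<lambda>r. \<Sum>i<N. c i * (of_real r * z) ^ i) \<longlongrightarrow> (\<Sum>i<N. c i * (of_real 1 * z) ^ i)) (at_left (1::real))"
      by (intro tendsto_intros)
    have "F (of_real r * z) = (\<Sum>i<N. c i * (of_real r * z) ^ i)" if "r \<in> {0<..<1}" for r :: real
      using z that by (intro F_eq) (simp add: norm_mult)
    then have "eventually (\<lambda>r. F (of_real r * z) = (\<Sum>i<N. c i * (of_real r * z) ^ i)) (at_left (1::real))"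
      by (rule eventually_mono[OF eventually_at_left_real[OF zero_less_one]])
    from tendsto_cong[OF this, THEN iffD2, OF lim']
    have "((\<lambda>r. F (of_real r * z)) \<longlongrightarrow> (\<Sum>i<N. c i * (of_real 1 * z) ^ i)) (at_left (1::real))" .
    with lim have "k z = (\<Sum>i<N. c i * (of_real 1 * z) ^ i)"
      by (rule tendsto_unique[OF trivial_limit_at_left_real])
    then show "k z = (\<Sum>i<N. c i * z ^ i)" by simp
  qed
  then show ?thesis unfolding c_def .
qed

lemma model_proj_power_eq:
  assumes h: "integrable circle_measure h"
  shows "model_proj (\<lambda>z. z ^ N) h \<in> model_space (\<lambda>z. z ^ N)"
    "AE z in circle_measure. model_proj (\<lambda>z. z ^ N) h z = (\<Sum>i<N. (\<integral>w. h w * cnj w ^ i \<partial>circle_measure) * z ^ i)"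
proof -
  let ?K = "model_space (\<lambda>z. z ^ N)"
  define c where "c i = (\<integral>w. h w * cnj w ^ i \<partial>circle_measure)" for i
  define f0 where "f0 z = (\<Sum>i<N. c i * z ^ i)" for z
  let ?P = "\<lambda>f. f \<in> ?K \<and> (\<forall>k\<in>?K. L2_inner (\<lambda>z. h z - f z) k = 0)"
  have Kint: "integrable circle_measure k" if "k \<in> ?K" for k
    using that L2_imp_circle_integrable unfolding model_space_def H2_def by blast
  have coef0: "(\<integral>w. f0 w * cnj w ^ i \<partial>circle_measure) = c i" if "i < N" for i
    using circle_inner_polynomials[of "{..<N}" "{i}" c "\<lambda>_. 1"] that unfolding f0_def by simp
  have f0K: "f0 \<in> ?K" unfolding f0_def[abs_def] by (rule polynomial_in_model_space_power)
  have "?P f0"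
  proof (intro conjI ballI f0K)
    fix k assume k: "k \<in> ?K"
    let ?p = "\<lambda>i. \<integral>w. k w * cnj w ^ i \<partial>circle_measure"
    have d: "integrable circle_measure (\<lambda>z. h z - f0 z)" using h Kint[OF f0K] by simp
    have "L2_inner (\<lambda>z. h z - f0 z) k = (\<integral>z. (\<Sum>i<N. cnj (?p i) * ((h z - f0 z) * cnj z ^ i)) \<partial>circle_measure)"
      unfolding L2_inner_def
    proof (rule integral_cong_AE)
      show "(\<lambda>z. (h z - f0 z) * cnj (k z)) \<in> borel_measurable circle_measure"
        by (intro borel_measurable_times borel_measurable_integrable[OF d] borel_measurable_integrable integrable_cnj Kint[OF k])
      show "(\<lambda>z. \<Sum>i<N. cnj (?p i) * ((h z - f0 z) * cnj z ^ i)) \<in> borel_measurable circle_measure"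
        by (intro borel_measurable_integrable Bochner_Integration.integrable_sum integrable_mult_right integrable_mult_continuous d continuous_intros)
      show "AE z in circle_measure. (h z - f0 z) * cnj (k z) = (\<Sum>i<N. cnj (?p i) * ((h z - f0 z) * cnj z ^ i))"
        using model_space_power_polynomial[OF k]
      proof eventually_elim
        case (elim z)
        then have "cnj (k z) = (\<Sum>i<N. cnj (?p i) * cnj z ^ i)" by simp
        then show ?case by (simp only: sum_distrib_left mult.left_commute)
      qed
    qed
    also have "\<dots> = (\<Sum>i<N. cnj (?p i) * (\<integral>z. (h z - f0 z) * cnj z ^ i \<partial>circle_measure))"
    proof -
      have "integrable circle_measure (\<lambda>z. (h z - f0 z) * cnj z ^ i)" for i
        by (intro integrable_mult_continuous d continuous_intros)
      then show ?thesis by (simp only: Bochner_Integration.integral_sum integrable_mult_right integral_mult_right_zero)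
    qed
    also have "\<dots> = 0"
    proof (intro sum.neutral ballI)
      fix i assume i: "i \<in> {..<N}"
      have "(\<integral>z. (h z - f0 z) * cnj z ^ i \<partial>circle_measure) = c i - (\<integral>w. f0 w * cnj w ^ i \<partial>circle_measure)"
        unfolding c_def left_diff_distrib
        by (intro Bochner_Integration.integral_diff integrable_mult_continuous h Kint[OF f0K] continuous_intros)
      then show "cnj (?p i) * (\<integral>z. (h z - f0 z) * cnj z ^ i \<partial>circle_measure) = 0" using coef0 i by simp
    qed
    finally show "L2_inner (\<lambda>z. h z - f0 z) k = 0" .
  qed
  then have P: "?P (model_proj (\<lambda>z. z ^ N) h)" unfolding model_proj_def by (rule someI[of ?P f0])
  then show m: "model_proj (\<lambda>z. z ^ N) h \<in> ?K" by blast
  let ?m = "model_proj (\<lambda>z. z ^ N) h"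
  have "(\<integral>w. ?m w * cnj w ^ i \<partial>circle_measure) = c i" if i: "i < N" for i
  proof -
    have "(\<lambda>z. z ^ i) \<in> ?K"
    proof -
      have "(\<Sum>j<N. (if j = i then 1 else 0) * z ^ j) = (\<Sum>j<N. if j = i then z ^ j else 0)" for z :: complex
        by (intro sum.cong) auto
      then have "(\<lambda>z. z ^ i) = (\<lambda>z::complex. \<Sum>j<N. (if j = i then 1 else 0) * z ^ j)"
        using i by simp
      then show ?thesis using polynomial_in_model_space_power[of "\<lambda>j. if j = i then 1 else 0" N] by simp
    qed
    then have "L2_inner (\<lambda>z. h z - ?m z) (\<lambda>z. z ^ i) = 0" using P by blast
    moreover have "L2_inner (\<lambda>z. h z - ?m z) (\<lambda>z. z ^ i) = c i - (\<integral>w. ?m w * cnj w ^ i \<partial>circle_measure)"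
      unfolding L2_inner_def c_def left_diff_distrib complex_cnj_power
      by (intro Bochner_Integration.integral_diff integrable_mult_continuous h Kint[OF m] continuous_intros)
    ultimately show ?thesis by simp
  qed
  then show "AE z in circle_measure. ?m z = (\<Sum>i<N. (\<integral>w. h w * cnj w ^ i \<partial>circle_measure) * z ^ i)"
    using model_space_power_polynomial[OF m] unfolding c_def by simp
qed

section \<open>Truncated Toeplitz operators as matrices\<close>

text \<open>
The matrix entry in row \<open>i\<close> and column \<open>j\<close> is the Fourier coefficient of index \<open>i - j\<close>. The numbers \<open>c m\<close> list the
coefficients in decreasing order, starting from index \<open>N - 1\<close>, which avoids negative indices.
\<close>
lemma tto_power_matrix:
  assumes \<phi>: "\<phi> \<in> L2" and fm: "f \<in> borel_measurable circle_measure"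
    and f: "AE z in circle_measure. f z = (\<Sum>j<N. p j * z ^ j)"
  defines "c \<equiv> \<lambda>m. \<integral>z. \<phi> z * cnj z ^ (N - 1) * z ^ m \<partial>circle_measure"
  shows "tto (\<lambda>z. z ^ N) \<phi> f \<in> model_space (\<lambda>z. z ^ N)"
    "AE z in circle_measure. tto (\<lambda>z. z ^ N) \<phi> f z = (\<Sum>i<N. (\<Sum>j<N. c (N - Suc i + j) * p j) * z ^ i)"
proof -
  let ?f = "\<lambda>z. \<Sum>j<N. p j * z ^ j"
  have \<phi>i: "integrable circle_measure \<phi>" by (rule L2_imp_circle_integrable[OF \<phi>])
  have \<phi>m: "\<phi> \<in> borel_measurable circle_measure" using \<phi>i by measurable
  have i0: "integrable circle_measure (\<lambda>z. \<phi> z * ?f z)"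
    by (intro integrable_mult_continuous \<phi>i continuous_intros)
  have ae: "AE z in circle_measure. \<phi> z * f z = \<phi> z * ?f z" using f by eventually_elim simp
  have i1: "integrable circle_measure (\<lambda>z. \<phi> z * f z)"
  proof (rule integrable_cong_AE[THEN iffD2, OF _ _ ae i0])
    show "(\<lambda>z. \<phi> z * f z) \<in> borel_measurable circle_measure" using \<phi>m fm by measurable
    show "(\<lambda>z. \<phi> z * ?f z) \<in> borel_measurable circle_measure" using i0 by (rule borel_measurable_integrable)
  qed
  have coef: "(\<integral>w. \<phi> w * f w * cnj w ^ i \<partial>circle_measure) = (\<Sum>j<N. c (N - Suc i + j) * p j)" if i: "i < N" for i
  proof -
    have "(\<integral>w. \<phi> w * f w * cnj w ^ i \<partial>circle_measure) = (\<integral>w. \<phi> w * ?f w * cnj w ^ i \<partial>circle_measure)"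
    proof (rule integral_cong_AE)
      show "AE w in circle_measure. \<phi> w * f w * cnj w ^ i = \<phi> w * ?f w * cnj w ^ i"
        using ae by eventually_elim simp
    qed (intro borel_measurable_integrable integrable_mult_continuous i0 i1 continuous_intros)+
    also have "\<dots> = (\<integral>w. (\<Sum>j<N. (\<phi> w * cnj w ^ (N - 1) * w ^ (N - Suc i + j)) * p j) \<partial>circle_measure)"
    proof (rule Bochner_Integration.integral_cong)
      fix w assume "w \<in> space circle_measure"
      then have w: "w \<in> torus" by simp
      have "cnj w ^ i = cnj w ^ (N - 1) * w ^ (N - Suc i)"
      proof -
        have "cnj w ^ (N - 1) = cnj w ^ i * cnj w ^ (N - Suc i)" using i by (simp flip: power_add)
        then have "cnj w ^ (N - 1) * w ^ (N - Suc i) = cnj w ^ i * (w ^ (N - Suc i) * cnj w ^ (N - Suc i))"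
          by (simp only: mult_ac)
        then show ?thesis unfolding torus_cnj_power_cancel[OF w] by simp
      qed
      then show "\<phi> w * ?f w * cnj w ^ i = (\<Sum>j<N. (\<phi> w * cnj w ^ (N - 1) * w ^ (N - Suc i + j)) * p j)"
        by (simp add: sum_distrib_left sum_distrib_right power_add mult_ac)
    qed simp
    also have "\<dots> = (\<Sum>j<N. \<integral>w. (\<phi> w * cnj w ^ (N - 1) * w ^ (N - Suc i + j)) * p j \<partial>circle_measure)"
      by (rule Bochner_Integration.integral_sum) (intro integrable_mult_continuous \<phi>i continuous_intros)
    also have "\<dots> = (\<Sum>j<N. c (N - Suc i + j) * p j)"
      unfolding c_def by (simp only: integral_mult_left_zero)
    finally show ?thesis .
  qed
  show "tto (\<lambda>z. z ^ N) \<phi> f \<in> model_space (\<lambda>z. z ^ N)"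
    unfolding tto_def by (rule model_proj_power_eq(1)[OF i1])
  show "AE z in circle_measure. tto (\<lambda>z. z ^ N) \<phi> f z = (\<Sum>i<N. (\<Sum>j<N. c (N - Suc i + j) * p j) * z ^ i)"
    using model_proj_power_eq(2)[OF i1, of N] coef unfolding tto_def by simp
qed

lemma L2_norm_polynomial:
  assumes m: "f \<in> borel_measurable circle_measure" and f: "AE z in circle_measure. f z = (\<Sum>i<N. a i * z ^ i)"
  shows "(L2_norm f)\<^sup>2 = (\<Sum>i<N. (norm (a i))\<^sup>2)"
proof -
  let ?p = "\<lambda>z. \<Sum>i<N. a i * z ^ i"
  have "(L2_norm f)\<^sup>2 = (\<integral>z. (norm (f z))\<^sup>2 \<partial>circle_measure)" unfolding L2_norm_def by simp
  also have "\<dots> = (\<integral>z. (norm (?p z))\<^sup>2 \<partial>circle_measure)"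
  proof (rule integral_cong_AE)
    show "(\<lambda>z. (norm (?p z))\<^sup>2) \<in> borel_measurable circle_measure"
      by (intro continuous_imp_circle_measurable continuous_intros)
    show "AE z in circle_measure. (norm (f z))\<^sup>2 = (norm (?p z))\<^sup>2" using f by eventually_elim simp
  qed (use m in measurable)
  also have "\<dots> = (\<Sum>i<N. (norm (a i))\<^sup>2)"
  proof -
    have "complex_of_real (\<integral>z. (norm (?p z))\<^sup>2 \<partial>circle_measure) = (\<integral>z. ?p z * cnj (?p z) \<partial>circle_measure)"
      unfolding complex_norm_square[symmetric] by (rule integral_complex_of_real[symmetric])
    also have "\<dots> = of_real (\<Sum>i<N. (norm (a i))\<^sup>2)"
      by (subst circle_inner_polynomials) (auto simp: complex_norm_square simp del: of_real_power)
    finally show ?thesis by (simp only: of_real_eq_iff)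
  qed
  finally show ?thesis .
qed

lemma tto_norm_scaled_polynomial:
  assumes \<phi>: "\<phi> \<in> L2" and f: "\<And>z. z \<in> torus \<Longrightarrow> f z = of_real \<alpha> * (\<Sum>j<N. p j * z ^ j)"
  defines "c \<equiv> \<lambda>m. \<integral>z. \<phi> z * cnj z ^ (N - 1) * z ^ m \<partial>circle_measure"
  shows "(L2_norm (tto (\<lambda>z. z ^ N) \<phi> f))\<^sup>2 = \<alpha>\<^sup>2 * (\<Sum>i<N. (norm (\<Sum>j<N. c (i + j) * p j))\<^sup>2)"
proof -
  have f': "f z = (\<Sum>j<N. (of_real \<alpha> * p j) * z ^ j)" if "z \<in> torus" for z
    using f[OF that] by (simp add: sum_distrib_left mult_ac)
  have "f \<in> borel_measurable circle_measure \<longleftrightarrow> (\<lambda>z. \<Sum>j<N. (of_real \<alpha> * p j) * z ^ j) \<in> borel_measurable circle_measure"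
    by (rule measurable_cong) (simp add: f')
  then have m: "f \<in> borel_measurable circle_measure"
    by (simp only:) (intro continuous_imp_circle_measurable continuous_intros)
  have "AE z in circle_measure. f z = (\<Sum>j<N. (of_real \<alpha> * p j) * z ^ j)" by (rule AE_I2) (simp add: f')
  note t = tto_power_matrix[OF \<phi> m this]
  have "tto (\<lambda>z. z ^ N) \<phi> f \<in> borel_measurable circle_measure"
    using t(1) unfolding model_space_def H2_def L2_def by blast
  from L2_norm_polynomial[OF this t(2)]
  have "(L2_norm (tto (\<lambda>z. z ^ N) \<phi> f))\<^sup>2 = (\<Sum>i<N. (norm (\<Sum>j<N. c (N - Suc i + j) * (of_real \<alpha> * p j)))\<^sup>2)"
    unfolding c_def .
  also have "\<dots> = (\<Sum>i<N. (norm (\<Sum>j<N. c (i + j) * (of_real \<alpha> * p j)))\<^sup>2)"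
    by (rule sum.nat_diff_reindex[of "\<lambda>i. (norm (\<Sum>j<N. c (i + j) * (of_real \<alpha> * p j)))\<^sup>2"])
  also have "\<dots> = (\<Sum>i<N. \<alpha>\<^sup>2 * (norm (\<Sum>j<N. c (i + j) * p j))\<^sup>2)"
  proof (rule sum.cong[OF refl])
    fix i
    have "(\<Sum>j<N. c (i + j) * (of_real \<alpha> * p j)) = of_real \<alpha> * (\<Sum>j<N. c (i + j) * p j)"
      unfolding sum_distrib_left by (intro sum.cong) auto
    then show "(norm (\<Sum>j<N. c (i + j) * (of_real \<alpha> * p j)))\<^sup>2 = \<alpha>\<^sup>2 * (norm (\<Sum>j<N. c (i + j) * p j))\<^sup>2"
      by (simp add: norm_mult power_mult_distrib)
  qed
  finally show ?thesis by (simp add: sum_distrib_left)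
qed

text \<open>
The normalizing factor of the kernels is the inverse of the norm of \<open>(l ^ j)\<close>, by the geometric sum.
\<close>
lemma kernel_normalization:
  fixes l :: complex
  assumes l: "norm l < 1" and N: "N \<ge> 1"
  defines "\<alpha> \<equiv> sqrt ((1 - (norm l)\<^sup>2) / (1 - (norm (l ^ N))\<^sup>2))"
  shows "\<alpha>\<^sup>2 > 0" "\<alpha>\<^sup>2 * (\<Sum>j<N. (norm l) ^ (2 * j)) = 1"
proof -
  have x: "(norm l)\<^sup>2 < 1" using l by (simp add: abs_square_less_1)
  have lN: "(norm (l ^ N))\<^sup>2 = ((norm l)\<^sup>2) ^ N" by (simp add: norm_power flip: power_mult add: mult.commute)
  have xN: "((norm l)\<^sup>2) ^ N < 1" using power_less_one_iff[of "(norm l)\<^sup>2" N] x N by simp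
  have a2: "\<alpha>\<^sup>2 = (1 - (norm l)\<^sup>2) / (1 - ((norm l)\<^sup>2) ^ N)"
    unfolding \<alpha>_def lN using x xN by simp
  then show "\<alpha>\<^sup>2 > 0" using x xN by simp
  have "(1 - (norm l)\<^sup>2) * (\<Sum>j<N. (norm l) ^ (2 * j)) = 1 - ((norm l)\<^sup>2) ^ N"
    using one_diff_power_eq[of "(norm l)\<^sup>2" N] by (simp add: power_mult)
  then show "\<alpha>\<^sup>2 * (\<Sum>j<N. (norm l) ^ (2 * j)) = 1" unfolding a2 using xN by simp
qed

lemma nkernel_power:
  assumes "norm l < 1" "z \<in> torus"
  shows "nkernel (\<lambda>z. z ^ N) l z = of_real (sqrt ((1 - (norm l)\<^sup>2) / (1 - (norm (l ^ N))\<^sup>2))) * (\<Sum>j<N. cnj l ^ j * z ^ j)"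
proof -
  have "norm (cnj l * z) < 1" using assms by (simp add: norm_mult)
  then have "cnj l * z \<noteq> 1" by auto
  then have "(1 - cnj (l ^ N) * z ^ N) / (1 - cnj l * z) = (\<Sum>j<N. cnj l ^ j * z ^ j)"
    using one_diff_power_eq[of "cnj l * z" N] by (simp add: power_mult_distrib)
  then show ?thesis unfolding nkernel_def by simp
qed

lemma ndiffquot_power:
  assumes "norm l < 1" "z \<in> torus"
  shows "ndiffquot (\<lambda>z. z ^ N) l z = of_real (sqrt ((1 - (norm l)\<^sup>2) / (1 - (norm (l ^ N))\<^sup>2))) * (\<Sum>j<N. l ^ (N - Suc j) * z ^ j)"
proof -
  have "z \<noteq> l" using assms by auto
  then have "(z ^ N - l ^ N) / (z - l) = (\<Sum>j<N. l ^ (N - Suc j) * z ^ j)"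
    using power_diff_sumr2[of z N l] by simp
  then show ?thesis unfolding ndiffquot_def by simp
qed

text \<open>
Difference quotients have the coefficients of the kernels in reverse order. Reversing rows and columns therefore
turns the bound on them into the test for the reversed sequence.
\<close>
lemma kernel_test_of_rho:
  assumes \<phi>: "\<phi> \<in> L2" and N: "N \<ge> 1" and r: "r \<ge> 0"
    and rho: "rho (\<lambda>z. z ^ N) (tto (\<lambda>z. z ^ N) \<phi>) \<le> ennreal r"
  defines "c \<equiv> \<lambda>m. \<integral>z. \<phi> z * cnj z ^ (N - 1) * z ^ m \<partial>circle_measure"
  shows "kernel_test N c r" "kernel_test N (\<lambda>m. c (2*N-2-m)) r"
proof -
  let ?T = "tto (\<lambda>z. z ^ N) \<phi>"
  have norm_le: "L2_norm (?T (nkernel (\<lambda>z. z ^ N) l)) \<le> r" "L2_norm (?T (ndiffquot (\<lambda>z. z ^ N) l)) \<le> r"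
    if l: "norm l < 1" for l
  proof -
    have "ennreal (L2_norm (?T (nkernel (\<lambda>z. z ^ N) l))) \<le> rho_r (\<lambda>z. z ^ N) ?T"
      unfolding rho_r_def by (rule SUP_upper) (use l in simp)
    also have "\<dots> \<le> ennreal r" using rho unfolding rho_def by simp
    finally show "L2_norm (?T (nkernel (\<lambda>z. z ^ N) l)) \<le> r" using r by simp
    have "ennreal (L2_norm (?T (ndiffquot (\<lambda>z. z ^ N) l))) \<le> rho_d (\<lambda>z. z ^ N) ?T"
      unfolding rho_d_def by (rule SUP_upper) (use l in simp)
    also have "\<dots> \<le> ennreal r" using rho unfolding rho_def by simp
    finally show "L2_norm (?T (ndiffquot (\<lambda>z. z ^ N) l)) \<le> r" using r by simp
  qed
  have key: "(\<Sum>i<N. (norm (\<Sum>j<N. c (i + j) * p j))\<^sup>2) \<le> r\<^sup>2 * (\<Sum>j<N. (norm l) ^ (2 * j))"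
    if l: "norm l < 1" and f: "\<And>z. z \<in> torus \<Longrightarrow> 
       f z = of_real (sqrt ((1 - (norm l)\<^sup>2) / (1 - (norm (l ^ N))\<^sup>2))) * (\<Sum>j<N. p j * z ^ j)"
      and le: "L2_norm (?T f) \<le> r" for l :: complex and p f
  proof -
    let ?\<alpha> = "sqrt ((1 - (norm l)\<^sup>2) / (1 - (norm (l ^ N))\<^sup>2))"
    let ?S = "\<Sum>i<N. (norm (\<Sum>j<N. c (i + j) * p j))\<^sup>2"
    let ?s = "\<Sum>j<N. (norm l) ^ (2 * j)"
    have "?\<alpha>\<^sup>2 * ?S = (L2_norm (?T f))\<^sup>2"
      using tto_norm_scaled_polynomial[OF \<phi> f] unfolding c_def by simp
    also have "\<dots> \<le> r\<^sup>2" using le by (intro power_mono) (auto simp: L2_norm_def)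
    also have "\<dots> = ?\<alpha>\<^sup>2 * (r\<^sup>2 * ?s)" using kernel_normalization(2)[OF l N] by (simp add: mult.left_commute)
    finally show ?thesis using kernel_normalization(1)[OF l N] by (simp only: mult_le_cancel_left_pos)
  qed
  show "kernel_test N c r"
    unfolding kernel_test_def
  proof (intro allI impI)
    fix l :: complex assume "norm l < 1"
    then have l: "norm (cnj l) < 1" by simp
    have "(\<Sum>i<N. (norm (\<Sum>j<N. c (i + j) * cnj (cnj l) ^ j))\<^sup>2) \<le> r\<^sup>2 * (\<Sum>j<N. (norm (cnj l)) ^ (2 * j))"
      by (rule key[OF l nkernel_power[OF l] norm_le(1)[OF l]])
    then show "(\<Sum>i<N. (norm (\<Sum>j<N. c (i + j) * l ^ j))\<^sup>2) \<le> r\<^sup>2 * (\<Sum>j<N. (norm l) ^ (2 * j))" by simp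
  qed
  show "kernel_test N (\<lambda>m. c (2*N-2-m)) r"
    unfolding kernel_test_def
  proof (intro allI impI)
    fix l :: complex assume l: "norm l < 1"
    let ?g = "\<lambda>i. (norm (\<Sum>j<N. c (2*N-2-(i + j)) * l ^ j))\<^sup>2"
    have "(\<Sum>i<N. ?g i) = (\<Sum>i<N. ?g (N - Suc i))"
      by (rule sum.nat_diff_reindex[symmetric])
    also have "\<dots> = (\<Sum>i<N. (norm (\<Sum>j<N. c (i + j) * l ^ (N - Suc j)))\<^sup>2)"
    proof (rule sum.cong[OF refl])
      fix i assume i: "i \<in> {..<N}"
      let ?h = "\<lambda>j. c (2*N-2-(N - Suc i + j)) * l ^ j"
      have "(\<Sum>j<N. ?h j) = (\<Sum>j<N. ?h (N - Suc j))" by (rule sum.nat_diff_reindex[symmetric])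
      also have "\<dots> = (\<Sum>j<N. c (i + j) * l ^ (N - Suc j))"
      proof (rule sum.cong[OF refl])
        fix j assume "j \<in> {..<N}"
        then have "2*N-2-(N - Suc i + (N - Suc j)) = i + j" using i by auto
        then show "?h (N - Suc j) = c (i + j) * l ^ (N - Suc j)" by simp
      qed
      finally show "?g (N - Suc i) = (norm (\<Sum>j<N. c (i + j) * l ^ (N - Suc j)))\<^sup>2" by (simp only:)
    qed
    also have "\<dots> \<le> r\<^sup>2 * (\<Sum>j<N. (norm l) ^ (2 * j))"
      by (rule key[OF l ndiffquot_power[OF l] norm_le(2)[OF l]])
    finally show "(\<Sum>i<N. ?g i) \<le> r\<^sup>2 * (\<Sum>j<N. (norm l) ^ (2 * j))" .
  qed
qed

text \<open>
The operator only depends on the coefficients \<open>c m\<close> with \<open>m \<le> 2N-2\<close>, and multiplication by \<open>z ^ (N - 1)\<close>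
compensates the shift of the index in their definition.
\<close>
lemma bounded_symbol_of_coefficients:
  assumes \<phi>: "\<phi> \<in> L2" and N: "N \<ge> 1" and \<psi>: "continuous_on torus \<psi>"
    and B: "B \<ge> 0" "\<And>z. z \<in> torus \<Longrightarrow> norm (\<psi> z) \<le> B"
    and coef: "\<And>m. m \<le> 2*N-2 \<Longrightarrow> 
      (\<integral>z. \<psi> z * z ^ m \<partial>circle_measure) = (\<integral>z. \<phi> z * cnj z ^ (N - 1) * z ^ m \<partial>circle_measure)"
  shows "\<exists>\<phi>\<^sub>0\<in>Linf. is_symbol (\<lambda>z. z ^ N) (tto (\<lambda>z. z ^ N) \<phi>) \<phi>\<^sub>0 \<and> Linf_norm \<phi>\<^sub>0 \<le> ennreal B"
proof (intro bexI conjI)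
  let ?\<phi>0 = "\<lambda>z. \<psi> z * z ^ (N - 1)"
  have c: "continuous_on torus ?\<phi>0" by (intro continuous_intros \<psi>)
  have le: "norm (?\<phi>0 z) \<le> B" if "z \<in> torus" for z using B(2)[OF that] that by (simp add: norm_mult norm_power)
  show le': "Linf_norm ?\<phi>0 \<le> ennreal B"
    unfolding Linf_norm_def
  proof (rule esssup_I)
    show "(\<lambda>z. ennreal (norm (?\<phi>0 z))) \<in> borel_measurable circle_measure"
      using continuous_imp_circle_measurable[OF c] by measurable
    show "AE z in circle_measure. ennreal (norm (?\<phi>0 z)) \<le> ennreal B"
      by (rule AE_I2, rule ennreal_leI, rule le) simp
  qed
  show "?\<phi>0 \<in> Linf"
    unfolding Linf_def
    using continuous_imp_circle_measurable[OF c] order_le_less_trans[OF le' ennreal_less_top] by simp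
  have L2: "?\<phi>0 \<in> L2" by (rule continuous_imp_L2[OF c])
  show "is_symbol (\<lambda>z. z ^ N) (tto (\<lambda>z. z ^ N) \<phi>) ?\<phi>0"
    unfolding is_symbol_def
  proof (intro conjI ballI L2)
    fix f assume "f \<in> tto_domain (\<lambda>z. z ^ N)"
    then have fK: "f \<in> model_space (\<lambda>z. z ^ N)" unfolding tto_domain_def by blast
    then have fm: "f \<in> borel_measurable circle_measure" unfolding model_space_def H2_def L2_def by blast
    define p where "p i = (\<integral>w. f w * cnj w ^ i \<partial>circle_measure)" for i
    have fp: "AE z in circle_measure. f z = (\<Sum>j<N. p j * z ^ j)"
      unfolding p_def by (rule model_space_power_polynomial[OF fK])
    define c where "c m = (\<integral>z. \<phi> z * cnj z ^ (N - 1) * z ^ m \<partial>circle_measure)" for m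
    have "(\<integral>z. ?\<phi>0 z * cnj z ^ (N - 1) * z ^ m \<partial>circle_measure) = c m" if m: "m \<le> 2*N-2" for m
    proof -
      have "(\<integral>z. ?\<phi>0 z * cnj z ^ (N - 1) * z ^ m \<partial>circle_measure) = (\<integral>z. \<psi> z * z ^ m \<partial>circle_measure)"
        by (rule Bochner_Integration.integral_cong) (simp_all add: mult.assoc[of "\<psi> _"] torus_cnj_power_cancel)
      then show ?thesis using coef[OF m] unfolding c_def by simp
    qed
    then have "(\<Sum>j<N. (\<integral>z. ?\<phi>0 z * cnj z ^ (N - 1) * z ^ (N - Suc i + j) \<partial>circle_measure) * p j)
       = (\<Sum>j<N. c (N - Suc i + j) * p j)" if "i < N" for i
      using that by (intro sum.cong) auto
    then have "AE z in circle_measure. tto (\<lambda>z. z ^ N) ?\<phi>0 f z = (\<Sum>i<N. (\<Sum>j<N. c (N - Suc i + j) * p j) * z ^ i)"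
      using tto_power_matrix(2)[OF L2 fm fp] by simp
    moreover have "AE z in circle_measure. tto (\<lambda>z. z ^ N) \<phi> f z = (\<Sum>i<N. (\<Sum>j<N. c (N - Suc i + j) * p j) * z ^ i)"
      using tto_power_matrix(2)[OF \<phi> fm fp] unfolding c_def .
    ultimately show "AE z in circle_measure. tto (\<lambda>z. z ^ N) \<phi> f z = tto (\<lambda>z. z ^ N) ?\<phi>0 f z"
      by eventually_elim simp
  qed
qed

theorem theorem6p3:
  "\<exists>C::real. C > 0 \<and>
     (\<forall>N::nat. N \<ge> 1 \<longrightarrow>
       (\<forall>\<phi>\<in>L2. \<exists>\<phi>\<^sub>0\<in>Linf.
          is_symbol (\<lambda>z. z ^ N) (tto (\<lambda>z. z ^ N) \<phi>) \<phi>\<^sub>0 \<and>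
          Linf_norm \<phi>\<^sub>0 \<le> ennreal C * rho (\<lambda>z. z ^ N) (tto (\<lambda>z. z ^ N) \<phi>)))"
proof (intro exI[of _ 38] conjI allI impI ballI)
  fix N :: nat and \<phi> assume N: "N \<ge> 1" and \<phi>: "\<phi> \<in> L2"
  let ?\<rho> = "rho (\<lambda>z. z ^ N) (tto (\<lambda>z. z ^ N) \<phi>)"
  define c where "c m = (\<integral>z. \<phi> z * cnj z ^ (N - 1) * z ^ m \<partial>circle_measure)" for m
  show "\<exists>\<phi>\<^sub>0\<in>Linf. is_symbol (\<lambda>z. z ^ N) (tto (\<lambda>z. z ^ N) \<phi>) \<phi>\<^sub>0 \<and> Linf_norm \<phi>\<^sub>0 \<le> ennreal 38 * ?\<rho>"
  proof (cases ?\<rho>)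
    case (real r)
    then have "?\<rho> \<le> ennreal r" by simp
    note test = kernel_test_of_rho[OF \<phi> N real(1) this, folded c_def]
    obtain \<psi> where \<psi>: "continuous_on torus \<psi>" "\<And>z. z \<in> torus \<Longrightarrow> norm (\<psi> z) \<le> 38 * r"
        "\<And>m. m \<le> 2*N-2 \<Longrightarrow> (\<integral>z. \<psi> z * z ^ m \<partial>circle_measure) = c m"
      using bounded_toeplitz_symbol[OF N real(1) test] by blast
    have "\<exists>\<phi>\<^sub>0\<in>Linf. is_symbol (\<lambda>z. z ^ N) (tto (\<lambda>z. z ^ N) \<phi>) \<phi>\<^sub>0 \<and> Linf_norm \<phi>\<^sub>0 \<le> ennreal (38 * r)"
      using real(1) by (intro bounded_symbol_of_coefficients[OF \<phi> N \<psi>(1) _ \<psi>(2) \<psi>(3)[unfolded c_def]]) auto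
    then show ?thesis using real by (simp add: ennreal_mult)
  next
    \<comment> \<open>the right-hand side is infinite, so a trigonometric polynomial with the right coefficients will do\<close>
    case top
    define \<psi> where "\<psi> z = cnj (\<Sum>m\<le>2*N-2. cnj (c m) * z ^ m)" for z
    have c\<psi>: "continuous_on torus \<psi>" unfolding \<psi>_def[abs_def] by (intro continuous_intros)
    obtain B where B: "B > 0" "\<And>z. z \<in> torus \<Longrightarrow> norm (\<psi> z) \<le> B"
      using continuous_imp_circle_bounded[OF c\<psi>] by blast
    have coef: "(\<integral>z. \<psi> z * z ^ m \<partial>circle_measure) = c m" if "m \<le> 2*N-2" for m
      using circle_inner_polynomials[of "{m}" "{..2*N-2}" "\<lambda>_. 1" "\<lambda>m. cnj (c m)"] that
      by (simp add: \<psi>_def mult.commute)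
    have "\<exists>\<phi>\<^sub>0\<in>Linf. is_symbol (\<lambda>z. z ^ N) (tto (\<lambda>z. z ^ N) \<phi>) \<phi>\<^sub>0 \<and> Linf_norm \<phi>\<^sub>0 \<le> ennreal B"
      using B(1) by (intro bounded_symbol_of_coefficients[OF \<phi> N c\<psi> _ B(2) coef[unfolded c_def]]) auto
    then show ?thesis using top by (auto simp: ennreal_mult_top)
  qed
qed simp

end
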